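(* Let $E\subset\mathbb R^n$ be the closure of a bounded Lipschitz domain, $\mathscr V(E)\subset\mathscr D_0^k(E)$ an $N$-dimensional subspace, and $\mathcal T=\{T_1,\dots,T_N\}\subset\mathscr A^k(E)$ unisolvent for $\mathscr V(E)$ such that $\mathcal H^k(\operatorname{supp}T_i\cap\operatorname{supp}T_j)=0$ for all $i\neq j$. Then the interpolation operator $\Pi:\mathscr D_0^k(E)\to\mathscr V(E)$ satisfies $\|\Pi\|_{\rm op}=\mathcal L(\mathcal T,\mathscr V(E))$.
   Context: $\mathscr D_0^k(E)$ is the Banach space of continuous maps $\omega:E\to\Lambda^k$ with norm $\|\omega\|_0=\sup_S\mathcal H^k(S)^{-1}|\int_S\omega|$, the supremum over oriented $\mathcal H^k$-measurable $k$-rectifiable sets $S\subset E$ with $0<\mathcal H^k(S)<\infty$, where $\int_S\omega=\int_S\langle\omega(x);\tau(x)\rangle d\mathcal H^k(x)$ and $\tau$ is the orientation (a unit simple $k$-vector field spanning the tangent space of the regular part of $S$). For such $S$, the averaging current is $T_S(\omega):=\mathcal H^k(S)^{-1}\int_S\omega$, and $\mathscr A^k(E)$ is the set of all such $T_S$. The support of a continuous linear functional $T$ on $\mathscr D_0^k(E)$ is the complement in $E$ of the union of all open sets $A$ such that $T(\omega)=0$ for all $\omega$ supported in $A$. $\mathcal T$ is unisolvent if $T_i(\omega)=0\ \forall i$, $\omega\in\mathscr V(E)$ imply $\omega=0$. The Lagrange basis $\{\omega_i\}\subset\mathscr V(E)$ satisfies $T_i(\omega_j)=\delta_{ij}$,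 $\Pi\omega=\sum_iT_i(\omega)\omega_i$, and $\mathcal L(\mathcal T,\mathscr V(E)):=\sup_{T\in\mathscr A^k(E)}\sum_{i=1}^N|T(\omega_i)|$. $\|\Pi\|_{\rm op}=\sup_{\|\omega\|_0=1}\|\Pi\omega\|_0$. *)

theory Defs
  imports "HOL-Analysis.Analysis"
begin

text \<open>The delta-approximating outer measure, with the usual normalisation constant
  unit_ball_vol k; empty covering sets contribute 0 (so that H^0 is counting measure).\<close>

definition hausdorff_delta :: "nat \<Rightarrow> real \<Rightarrow> (real^'n::finite) set \<Rightarrow> ennreal" where
  "hausdorff_delta k \<delta> S =
     (INF C \<in> {C :: nat \<Rightarrow> (real^'n) set. S \<subseteq> (\<Union>i. C i) \<and>
                 (\<forall>i. bounded (C i) \<and> diameter (C i) \<le> \<delta>)}.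
        (\<Sum>i. (if C i = {} then 0
               else ennreal (unit_ball_vol (real k) * (diameter (C i) / 2) ^ k))))"

definition hausdorff_outer :: "nat \<Rightarrow> (real^'n::finite) set \<Rightarrow> ennreal" where
  "hausdorff_outer k S = (SUP \<delta> \<in> {0<..}. hausdorff_delta k \<delta> S)"

definition hausdorff_measure :: "nat \<Rightarrow> (real^'n::finite) measure" where
  "hausdorff_measure k =
     measure_of UNIV (lambda_system UNIV UNIV (hausdorff_outer k)) (hausdorff_outer k)"

text \<open>A k-covector (element of Lambda^k) is represented as an alternating k-linear form,
  acting on the first k entries of a sequence of vectors.\<close>
type_synonym 'n covector = "(nat \<Rightarrow> real^'n::finite) \<Rightarrow> real"

definition alt_form :: "nat \<Rightarrow> ('n::finite) covector \<Rightarrow> bool" where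
  "alt_form k \<phi> \<longleftrightarrow>
     (\<forall>v w. (\<forall>i<k. v i = w i) \<longrightarrow> \<phi> v = \<phi> w) \<and>
     (\<forall>i<k. \<forall>v. linear (\<lambda>u. \<phi> (v(i := u)))) \<and>
     (\<forall>v i j. i < k \<and> j < k \<and> i \<noteq> j \<and> v i = v j \<longrightarrow> \<phi> v = 0)"

text \<open>D_0^k(E): continuous maps E -> Lambda^k (canonically extended by 0 outside E).
  Continuity into the finite-dimensional space Lambda^k means continuity of every evaluation.\<close>
definition D0 :: "nat \<Rightarrow> (real^'n::finite) set \<Rightarrow> (real^'n \<Rightarrow> 'n covector) set" where
  "D0 k E = {\<omega>. (\<forall>x\<in>E. alt_form k (\<omega> x)) \<and> (\<forall>x. x \<notin> E \<longrightarrow> \<omega> x = (\<lambda>_. 0)) \<and>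
                (\<forall>v. continuous_on E (\<lambda>x. \<omega> x v))}"

definition k_rectifiable :: "nat \<Rightarrow> (real^'n::finite) set \<Rightarrow> bool" where
  "k_rectifiable k S \<longleftrightarrow>
     S \<in> sets (hausdorff_measure k) \<and>
     (\<exists>(N :: (real^'n) set) (L :: nat \<Rightarrow> (real^'n) set) (F :: nat \<Rightarrow> real^'n \<Rightarrow> real^'n).
        hausdorff_outer k N = 0 \<and>
        (\<forall>i. subspace (L i) \<and> dim (L i) = k \<and> (\<exists>C. C-lipschitz_on (L i) (F i))) \<and>
        S \<subseteq> N \<union> (\<Union>i. F i ` L i))"

definition approx_tangent :: "nat \<Rightarrow> (real^'n::finite) set \<Rightarrow> real^'n \<Rightarrow> (real^'n) set \<Rightarrow> bool" where
  "approx_tangent k S x P \<longleftrightarrow> subspace P \<and> dim P = k \<and>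
     (\<forall>f :: real^'n \<Rightarrow> real. continuous_on UNIV f \<and> compact (closure {y. f y \<noteq> 0}) \<longrightarrow>
        ((\<lambda>r. (1 / r ^ k) * (LINT y:S|hausdorff_measure k. f ((1 / r) *\<^sub>R (y - x))))
           \<longlongrightarrow> (LINT y:P|hausdorff_measure k. f y)) (at_right 0))"

text \<open>An orientation of S: a sign sigma and an orthonormal k-frame v, measurable on S, such that
  at H^k-a.e. point of S the approximate tangent space exists and is spanned by the frame; the
  unit simple k-vector is tau(x) = sigma(x) v_0(x) wedge ... wedge v_(k-1)(x).\<close>
definition orientation :: "nat \<Rightarrow> (real^'n::finite) set \<Rightarrow> (real^'n \<Rightarrow> real) \<Rightarrow> (real^'n \<Rightarrow> nat \<Rightarrow> real^'n) \<Rightarrow> bool" where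
  "orientation k S \<sigma> v \<longleftrightarrow>
     \<sigma> \<in> borel_measurable (restrict_space (hausdorff_measure k) S) \<and>
     (\<forall>i<k. (\<lambda>x. v x i) \<in> borel_measurable (restrict_space (hausdorff_measure k) S)) \<and>
     (AE x in hausdorff_measure k. x \<in> S \<longrightarrow>
        (\<sigma> x = 1 \<or> \<sigma> x = -1) \<and>
        (\<forall>i<k. \<forall>j<k. v x i \<bullet> v x j = (if i = j then 1 else 0)) \<and>
        approx_tangent k S x (span (v x ` {..<k})))"

definition admissible :: "nat \<Rightarrow> (real^'n::finite) set \<Rightarrow> (real^'n) set \<Rightarrow> (real^'n \<Rightarrow> real) \<Rightarrow> (real^'n \<Rightarrow> nat \<Rightarrow> real^'n) \<Rightarrow> bool" where
  "admissible k E S \<sigma> v \<longleftrightarrow> S \<subseteq> E \<and> k_rectifiable k S \<and> orientation k S \<sigma> v \<and>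
     0 < hausdorff_outer k S \<and> hausdorff_outer k S < \<infinity>"

definition form_integral :: "nat \<Rightarrow> (real^'n::finite) set \<Rightarrow> (real^'n \<Rightarrow> real) \<Rightarrow> (real^'n \<Rightarrow> nat \<Rightarrow> real^'n) \<Rightarrow> (real^'n \<Rightarrow> 'n covector) \<Rightarrow> real" where
  "form_integral k S \<sigma> v \<omega> = (LINT x:S|hausdorff_measure k. \<sigma> x * \<omega> x (v x))"

definition avg_current :: "nat \<Rightarrow> (real^'n::finite) set \<Rightarrow> (real^'n \<Rightarrow> real) \<Rightarrow> (real^'n \<Rightarrow> nat \<Rightarrow> real^'n) \<Rightarrow> (real^'n \<Rightarrow> 'n covector) \<Rightarrow> real" where
  "avg_current k S \<sigma> v \<omega> = form_integral k S \<sigma> v \<omega> / enn2real (hausdorff_outer k S)"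

definition averaging_currents :: "nat \<Rightarrow> (real^'n::finite) set \<Rightarrow> ((real^'n \<Rightarrow> 'n covector) \<Rightarrow> real) set" where
  "averaging_currents k E = {avg_current k S \<sigma> v | S \<sigma> v. admissible k E S \<sigma> v}"

definition norm0 :: "nat \<Rightarrow> (real^'n::finite) set \<Rightarrow> (real^'n \<Rightarrow> 'n covector) \<Rightarrow> real" where
  "norm0 k E \<omega> = Sup {\<bar>avg_current k S \<sigma> v \<omega>\<bar> | S \<sigma> v. admissible k E S \<sigma> v}"

definition current_support :: "nat \<Rightarrow> (real^'n::finite) set \<Rightarrow> ((real^'n \<Rightarrow> 'n covector) \<Rightarrow> real) \<Rightarrow> (real^'n) set" where
  "current_support k E T = E - \<Union>{A. open A \<and>
      (\<forall>\<omega>\<in>D0 k E. closure {x. \<omega> x \<noteq> (\<lambda>_. 0)} \<subseteq> A \<longrightarrow> T \<omega> = 0)}"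

definition lipschitz_domain :: "(real^'n::finite) set \<Rightarrow> bool" where
  "lipschitz_domain \<Omega> \<longleftrightarrow> open \<Omega> \<and> bounded \<Omega> \<and> connected \<Omega> \<and> \<Omega> \<noteq> {} \<and>
     (\<forall>p\<in>frontier \<Omega>. \<exists>(e :: real^'n) r h L (g :: real^'n \<Rightarrow> real).
        norm e = 1 \<and> 0 < r \<and> 0 < h \<and> L-lipschitz_on {y. y \<bullet> e = 0} g \<and>
        (let C = {x. norm ((x - p) - ((x - p) \<bullet> e) *\<^sub>R e) < r \<and> \<bar>(x - p) \<bullet> e\<bar> < h} in
          \<Omega> \<inter> C = {x\<in>C. x \<bullet> e < g (x - (x \<bullet> e) *\<^sub>R e)} \<and>
          frontier \<Omega> \<inter> C = {x\<in>C. x \<bullet> e = g (x - (x \<bullet> e) *\<^sub>R e)}))"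

definition lin_comb :: "nat \<Rightarrow> (nat \<Rightarrow> real) \<Rightarrow> (nat \<Rightarrow> real^'n::finite \<Rightarrow> 'n covector) \<Rightarrow> real^'n \<Rightarrow> 'n covector" where
  "lin_comb N c b = (\<lambda>x w. \<Sum>i<N. c i * b i x w)"

definition fin_dim_subspace :: "nat \<Rightarrow> nat \<Rightarrow> (real^'n::finite) set \<Rightarrow> (real^'n \<Rightarrow> 'n covector) set \<Rightarrow> bool" where
  "fin_dim_subspace k N E V \<longleftrightarrow> V \<subseteq> D0 k E \<and>
     (\<lambda>_ _. 0) \<in> V \<and>
     (\<forall>\<omega>\<in>V. \<forall>\<eta>\<in>V. \<forall>a b. (\<lambda>x w. a * \<omega> x w + b * \<eta> x w) \<in> V) \<and>
     (\<exists>b. (\<forall>i<N. b i \<in> V) \<and>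
          (\<forall>c. lin_comb N c b = (\<lambda>_ _. 0) \<longrightarrow> (\<forall>i<N. c i = 0)) \<and>
          (\<forall>\<omega>\<in>V. \<exists>c. \<omega> = lin_comb N c b))"

definition interp :: "nat \<Rightarrow> (nat \<Rightarrow> (real^'n::finite \<Rightarrow> 'n covector) \<Rightarrow> real) \<Rightarrow> (nat \<Rightarrow> real^'n \<Rightarrow> 'n covector) \<Rightarrow> (real^'n \<Rightarrow> 'n covector) \<Rightarrow> real^'n \<Rightarrow> 'n covector" where
  "interp N T \<omega>s \<omega> = lin_comb N (\<lambda>i. T i \<omega>) \<omega>s"

end

theory Submission
  imports Defs "Jordan_Normal_Form.Determinant"
begin

no_notation scalar_prod (infix \<open>\<bullet>\<close> 70)
no_notation vec_index (infixl \<open>$\<close> 100)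

text \<open>The inequality \<open>\<parallel>\<Pi>\<parallel> \<le> \<L>\<close> is immediate from \<open>S (\<Pi> \<omega>) = (\<Sum>i<N. T i \<omega> * S (\<omega>s i))\<close> and
  \<open>\<bar>T i \<omega>\<bar> \<le> \<parallel>\<omega>\<parallel>\<close>. For the converse, given an averaging current \<open>S\<close>, one looks for a form \<open>\<omega>\<close> of norm at
  most 1 with \<open>T i \<omega>\<close> close to \<open>sgn (S (\<omega>s i))\<close> for all \<open>i\<close>. The set carrying \<open>T i\<close> lies in the support of
  \<open>T i\<close> up to a null set, so these sets overlap only in null sets, and Lusin's theorem gives disjoint
  compact subsets of almost full measure on which the orienting frames are continuous. Extending
  the frames by Dugundji's theorem to continuous maps into the unit ball and taking Gram
  determinants against them yields \<open>\<omega>\<close>; its comass is at most 1 by Hadamard's inequality.\<close>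

section \<open>Hausdorff measure\<close>

text \<open>The norm is a supremum of averages over sets, whereas a form is built pointwise. One
  comparison bridges the two: a form bounded by 1 on all orthonormal \<open>k\<close>-frames has
  norm at most 1, because an orientation is an orthonormal frame almost everywhere. A continuous
  extension of a frame keeps each vector in the unit ball but does not keep the vectors orthonormal,
  so the Gram determinant has to be bounded for arbitrary vectors of length at most 1. The
  hypothesis speaks of supports, the construction of carrying sets. That a carrier exceeds its
  support only by a null set is proved by the same extension: otherwise a form supported where the
  current vanishes would have a non-zero average. Since \<open>hausdorff_measure k\<close> is not
  \<sigma>-finite for \<open>k\<close> below the dimension, inner regularity is only available after
  restriction to sets of finite measure. The signs are attained only up to \<open>e\<close>. For a
  fixed averaging current \<open>S\<close> the resulting loss is at most \<open>e\<close> times the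
  sum of the \<bar>\<open>S (\<omega>s i)\<close>\<bar>, which vanishes as \<open>e\<close> tends to
  0.\<close>

definition hausdorff_gauge :: "nat \<Rightarrow> (real^'n::finite) set \<Rightarrow> ennreal" where
  "hausdorff_gauge k C =
     (if C = {} then 0 else ennreal (unit_ball_vol (real k) * (diameter C / 2) ^ k))"

definition fine_covers :: "real \<Rightarrow> (real^'n::finite) set \<Rightarrow> (nat \<Rightarrow> (real^'n) set) set" where
  "fine_covers \<delta> S = {C. S \<subseteq> (\<Union>i. C i) \<and> (\<forall>i. bounded (C i) \<and> diameter (C i) \<le> \<delta>)}"

lemma hausdorff_delta_eq:
  "hausdorff_delta k \<delta> S = (INF C\<in>fine_covers \<delta> S. \<Sum>i. hausdorff_gauge k (C i))"
  by (simp add: hausdorff_delta_def fine_covers_def hausdorff_gauge_def)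

lemma hausdorff_gauge_closure:
  "bounded C \<Longrightarrow> hausdorff_gauge k (closure C) = hausdorff_gauge k C"
  by (simp add: hausdorff_gauge_def diameter_closure)

lemma hausdorff_delta_le:
  "C \<in> fine_covers \<delta> S \<Longrightarrow> hausdorff_delta k \<delta> S \<le> (\<Sum>i. hausdorff_gauge k (C i))"
  unfolding hausdorff_delta_eq by (rule INF_lower)

lemma hausdorff_delta_less:
  assumes "hausdorff_delta k \<delta> S < t"
  obtains C where "C \<in> fine_covers \<delta> S" "(\<Sum>i. hausdorff_gauge k (C i)) < t"
  using assms unfolding hausdorff_delta_eq INF_less_iff by blast

lemma hausdorff_delta_mono: "S \<subseteq> S' \<Longrightarrow> hausdorff_delta k \<delta> S \<le> hausdorff_delta k \<delta> S'"
  unfolding hausdorff_delta_eq by (rule INF_superset_mono) (auto simp: fine_covers_def)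

lemma hausdorff_delta_antimono:
  "\<delta> \<le> \<delta>' \<Longrightarrow> hausdorff_delta k \<delta>' S \<le> hausdorff_delta k \<delta> S"
  unfolding hausdorff_delta_eq
  by (rule INF_superset_mono) (auto simp: fine_covers_def intro: order_trans)

lemma hausdorff_delta_empty: "0 \<le> \<delta> \<Longrightarrow> hausdorff_delta k \<delta> {} = 0"
proof -
  assume "0 \<le> \<delta>"
  then have "(\<lambda>_. {}) \<in> fine_covers \<delta> ({} :: (real^'n) set)"
    by (simp add: fine_covers_def)
  from hausdorff_delta_le[OF this, of k] show ?thesis
    by (simp add: hausdorff_gauge_def)
qed

text \<open>Near-optimal covers of the \<open>A i\<close>, with excesses summing to
  \<open>e\<close>, are interleaved by \<open>prod_decode\<close> into one cover of the
  union.\<close>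

lemma hausdorff_delta_UN:
  "hausdorff_delta k \<delta> (\<Union>i::nat. A i) \<le> (\<Sum>i. hausdorff_delta k \<delta> (A i))"
proof (rule ennreal_le_epsilon)
  fix e :: real assume e: "0 < e" and fin: "(\<Sum>i. hausdorff_delta k \<delta> (A i)) < Orderings.top"
  have "\<exists>B. B \<in> fine_covers \<delta> (A i) \<and>
      (\<Sum>j. hausdorff_gauge k (B j)) < hausdorff_delta k \<delta> (A i) + e * (1/2)^Suc i" for i
  proof -
    have "hausdorff_delta k \<delta> (A i) < hausdorff_delta k \<delta> (A i) + e * (1/2)^Suc i"
      using fin e by (auto simp add: less_top dest!: ennreal_suminf_lessD)
    then show ?thesis by (metis hausdorff_delta_less)
  qed
  then obtain B where B: "\<And>i. B i \<in> fine_covers \<delta> (A i)"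
    and Bl: "\<And>i. (\<Sum>j. hausdorff_gauge k (B i j)) < hausdorff_delta k \<delta> (A i) + e * (1/2)^Suc i"
    by metis
  define C where "C = case_prod B o prod_decode"
  have "C \<in> fine_covers \<delta> (\<Union>i. A i)"
    unfolding fine_covers_def
  proof (safe, goal_cases)
    case (1 x i)
    then obtain j where "x \<in> B i j" using B[of i] by (auto simp: fine_covers_def)
    then have "x \<in> C (prod_encode (i, j))" by (simp add: C_def)
    then show ?case by blast
  qed (use B in \<open>auto simp: C_def fine_covers_def split: prod.split\<close>)
  then have "hausdorff_delta k \<delta> (\<Union>i. A i) \<le> (\<Sum>m. hausdorff_gauge k (C m))"
    by (rule hausdorff_delta_le)
  also have "\<dots> = (\<Sum>i. \<Sum>j. hausdorff_gauge k (B i j))"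
    using suminf_ennreal_2dimen[of "\<lambda>i. \<Sum>j. hausdorff_gauge k (B i j)"
        "\<lambda>(i, j). hausdorff_gauge k (B i j)"]
    by (simp add: C_def split_def)
  also have "\<dots> \<le> (\<Sum>i. hausdorff_delta k \<delta> (A i) + e * (1/2) ^ Suc i)"
    using Bl by (intro suminf_le) (auto intro: less_imp_le)
  also have "... = (\<Sum>i. hausdorff_delta k \<delta> (A i)) + (\<Sum>n. ennreal e * ennreal ((1/2) ^ Suc n))"
    using e by (subst suminf_add[symmetric])
       (auto simp del: ennreal_suminf_cmult simp add: ennreal_mult[symmetric])
  also have "\<dots> = (\<Sum>i. hausdorff_delta k \<delta> (A i)) + e"
    unfolding ennreal_suminf_cmult
    by (subst suminf_ennreal_eq[OF zero_le_power power_half_series]) auto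
  finally show "hausdorff_delta k \<delta> (\<Union>i. A i) \<le> (\<Sum>i. hausdorff_delta k \<delta> (A i)) + ennreal e" .
qed

section \<open>The Hausdorff outer measure and its measurable sets\<close>

lemma hausdorff_delta_le_outer: "0 < \<delta> \<Longrightarrow> hausdorff_delta k \<delta> S \<le> hausdorff_outer k S"
  unfolding hausdorff_outer_def by (rule SUP_upper) simp

lemma hausdorff_outer_empty [simp]: "hausdorff_outer k {} = 0"
  by (simp add: hausdorff_outer_def hausdorff_delta_empty)

lemma hausdorff_outer_mono: "S \<subseteq> S' \<Longrightarrow> hausdorff_outer k S \<le> hausdorff_outer k S'"
  unfolding hausdorff_outer_def by (intro SUP_mono) (auto intro: hausdorff_delta_mono)

lemma hausdorff_outer_UN:
  "hausdorff_outer k (\<Union>i::nat. A i) \<le> (\<Sum>i. hausdorff_outer k (A i))"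
  unfolding hausdorff_outer_def[of k "\<Union>i. A i"]
proof (rule SUP_least)
  fix \<delta> :: real assume "\<delta> \<in> {0<..}"
  then have "(\<Sum>i. hausdorff_delta k \<delta> (A i)) \<le> (\<Sum>i. hausdorff_outer k (A i))"
    by (intro suminf_le) (auto intro: hausdorff_delta_le_outer)
  with hausdorff_delta_UN
  show "hausdorff_delta k \<delta> (\<Union>i. A i) \<le> (\<Sum>i. hausdorff_outer k (A i))"
    by (rule order_trans)
qed

lemma outer_measure_space_hausdorff: "outer_measure_space UNIV (hausdorff_outer k)"
  unfolding outer_measure_space_def positive_def increasing_def countably_subadditive_def
  using hausdorff_outer_mono hausdorff_outer_UN by auto

lemma hausdorff_outer_Un: "hausdorff_outer k (A \<union> B) \<le> hausdorff_outer k A + hausdorff_outer k B"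
proof -
  interpret sigma_algebra UNIV "UNIV :: (real^'a) set set"
    using sigma_algebra_Pow[of UNIV] by simp
  have "subadditive UNIV (hausdorff_outer k :: (real^'a) set \<Rightarrow> _)"
    using countably_subadditive_subadditive outer_measure_space_hausdorff
    by (auto simp: outer_measure_space_def)
  then have "hausdorff_outer k (A \<union> (B - A)) \<le> hausdorff_outer k A + hausdorff_outer k (B - A)"
    unfolding subadditive_def by (metis Diff_disjoint UNIV_I)
  also have "\<dots> \<le> hausdorff_outer k A + hausdorff_outer k B"
    by (intro add_left_mono hausdorff_outer_mono) auto
  finally show ?thesis by simp
qed

lemma measure_space_hausdorff:
  "measure_space UNIV (lambda_system UNIV UNIV (hausdorff_outer k)) (hausdorff_outer k)"
proof -
  interpret sigma_algebra UNIV "UNIV :: (real^'a) set set"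
    using sigma_algebra_Pow[of UNIV] by simp
  show ?thesis by (rule caratheodory_lemma[OF outer_measure_space_hausdorff])
qed

lemma space_hausdorff [simp]: "space (hausdorff_measure k) = UNIV"
  by (simp add: hausdorff_measure_def space_measure_of_conv)

lemma sets_hausdorff: "sets (hausdorff_measure k) = lambda_system UNIV UNIV (hausdorff_outer k)"
  unfolding hausdorff_measure_def
  by (simp add: sigma_algebra.sigma_sets_eq[OF
        measure_space_hausdorff[unfolded measure_space_def, THEN conjunct1]])

lemma emeasure_hausdorff:
  assumes "S \<in> sets (hausdorff_measure k)"
  shows "emeasure (hausdorff_measure k) S = hausdorff_outer k S"
  unfolding hausdorff_measure_def
  by (rule emeasure_measure_of_sigma)
    (use measure_space_hausdorff assms in \<open>auto simp: measure_space_def sets_hausdorff\<close>)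

lemma hausdorff_measurableI:
  assumes "\<And>A. hausdorff_outer k A < \<infinity> \<Longrightarrow>
      hausdorff_outer k (A \<inter> S) + hausdorff_outer k (A - S) \<le> hausdorff_outer k A"
  shows "S \<in> sets (hausdorff_measure k)"
proof -
  have "hausdorff_outer k (S \<inter> A) + hausdorff_outer k ((UNIV - S) \<inter> A) = hausdorff_outer k A" for A
  proof (rule antisym)
    have eq: "S \<inter> A = A \<inter> S" "(UNIV - S) \<inter> A = A - S" by auto
    show "hausdorff_outer k (S \<inter> A) + hausdorff_outer k ((UNIV - S) \<inter> A) \<le> hausdorff_outer k A"
      using assms[of A] unfolding eq by (cases "hausdorff_outer k A < \<infinity>") (auto simp: less_top[symmetric])
    show "hausdorff_outer k A \<le> hausdorff_outer k (S \<inter> A) + hausdorff_outer k ((UNIV - S) \<inter> A)"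
      using hausdorff_outer_Un[of k "S \<inter> A" "(UNIV - S) \<inter> A"]
      by (metis Compl_eq_Diff_UNIV Int_Un_distrib2 Int_UNIV_left Un_commute Compl_partition)
  qed
  then show ?thesis by (simp add: sets_hausdorff lambda_system_def)
qed

lemma hausdorff_null_sets:
  assumes "hausdorff_outer k S = 0"
  shows "S \<in> null_sets (hausdorff_measure k)"
proof -
  have "S \<in> sets (hausdorff_measure k)"
  proof (rule hausdorff_measurableI)
    fix A
    have "hausdorff_outer k (A \<inter> S) = 0"
      using hausdorff_outer_mono[of "A \<inter> S" S k] assms by simp
    moreover have "hausdorff_outer k (A - S) \<le> hausdorff_outer k A"
      by (rule hausdorff_outer_mono) auto
    ultimately show "hausdorff_outer k (A \<inter> S) + hausdorff_outer k (A - S) \<le> hausdorff_outer k A"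
      by simp
  qed
  then show ?thesis using assms by (simp add: null_sets_def emeasure_hausdorff)
qed

text \<open>A set of diameter less than \<open>d\<close> cannot meet both \<open>A\<close> and
  \<open>B\<close>, so a fine cover of the union splits into a cover of each. This is the property
  of a metric outer measure on which the measurability of closed sets rests.\<close>

lemma hausdorff_outer_separated:
  assumes d: "0 < d" and sep: "\<And>x y. x \<in> A \<Longrightarrow> y \<in> B \<Longrightarrow> d \<le> dist x y"
  shows "hausdorff_outer k A + hausdorff_outer k B \<le> hausdorff_outer k (A \<union> B)"
proof -
  have small: "hausdorff_delta k \<delta> A + hausdorff_delta k \<delta> B \<le> hausdorff_delta k \<delta> (A \<union> B)"
    if \<delta>: "0 < \<delta>" "\<delta> < d" for \<delta>
    unfolding hausdorff_delta_eq[of k \<delta> "A \<union> B"]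
  proof (rule INF_greatest)
    fix C assume C: "C \<in> fine_covers \<delta> (A \<union> B)"
    \<comment> \<open>Sets missing \<open>X\<close> are emptied rather than dropped, which keeps the
      indexing; the empty set has gauge 0 even for \<open>k = 0\<close>.\<close>
    define P where "P X i = (if C i \<inter> X = {} then {} else C i)" for X i
    have "P A \<in> fine_covers \<delta> A" "P B \<in> fine_covers \<delta> B"
      using C \<delta> unfolding fine_covers_def P_def by (auto; blast)+
    then have "hausdorff_delta k \<delta> A + hausdorff_delta k \<delta> B
        \<le> (\<Sum>i. hausdorff_gauge k (P A i)) + (\<Sum>i. hausdorff_gauge k (P B i))"
      by (intro add_mono hausdorff_delta_le)
    also have "\<dots> = (\<Sum>i. hausdorff_gauge k (P A i) + hausdorff_gauge k (P B i))"
      by (rule suminf_add) auto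
    also have "\<dots> \<le> (\<Sum>i. hausdorff_gauge k (C i))"
    proof (rule suminf_le)
      fix i
      have "C i \<inter> A = {} \<or> C i \<inter> B = {}"
      proof (rule ccontr)
        assume "\<not> ?thesis"
        then obtain x y where xy: "x \<in> C i" "x \<in> A" "y \<in> C i" "y \<in> B" by blast
        have "bounded (C i)" "diameter (C i) \<le> \<delta>" using C by (auto simp: fine_covers_def)
        with xy have "dist x y \<le> \<delta>" using diameter_bounded_bound[of "C i" x y] by simp
        with sep[of x y] xy \<delta> show False by simp
      qed
      then show "hausdorff_gauge k (P A i) + hausdorff_gauge k (P B i) \<le> hausdorff_gauge k (C i)"
        by (auto simp: P_def hausdorff_gauge_def)
    qed auto
    finally show "hausdorff_delta k \<delta> A + hausdorff_delta k \<delta> B \<le> (\<Sum>i. hausdorff_gauge k (C i))" .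
  qed
  \<comment> \<open>Independent scales let the two suprema be separated; both scales are refined to
    the common \<open>m\<close>.\<close>
  have "hausdorff_delta k \<delta> A + hausdorff_delta k \<delta>' B \<le> hausdorff_outer k (A \<union> B)"
    if "0 < \<delta>" "0 < \<delta>'" for \<delta> \<delta>'
  proof -
    define m where "m = min (min \<delta> \<delta>') (d / 2)"
    have m: "0 < m" "m < d" "m \<le> \<delta>" "m \<le> \<delta>'" using that d by (auto simp: m_def)
    then have "hausdorff_delta k \<delta> A + hausdorff_delta k \<delta>' B
        \<le> hausdorff_delta k m A + hausdorff_delta k m B"
      by (intro add_mono hausdorff_delta_antimono)
    also have "\<dots> \<le> hausdorff_outer k (A \<union> B)"
      using small[OF m(1,2)] hausdorff_delta_le_outer[OF m(1)] by (rule order_trans)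
    finally show ?thesis .
  qed
  then have "(SUP \<delta>\<in>{0<..}. SUP \<delta>'\<in>{0<..}. hausdorff_delta k \<delta> A + hausdorff_delta k \<delta>' B)
      \<le> hausdorff_outer k (A \<union> B)"
    by (intro SUP_least) auto
  then show ?thesis
    by (simp add: hausdorff_outer_def[of k A] hausdorff_outer_def[of k B]
        ennreal_SUP_add_left ennreal_SUP_add_right[symmetric])
qed

text \<open>Caratheodory's criterion. \<open>A \<inter> F\<close> has positive distance from each
  \<open>D n\<close>, so additivity holds with \<open>D n\<close> in place of \<open>A - F\<close>;
  what remains is that the part of \<open>A - F\<close> missed by \<open>D n\<close> has measure
  tending to 0.\<close>

lemma closed_hausdorff_measurable:
  fixes F :: "(real^'n::finite) set"
  assumes F: "closed F"
  shows "F \<in> sets (hausdorff_measure k)"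
proof (cases "F = {}")
  case False
  show ?thesis
  proof (rule hausdorff_measurableI)
    fix A :: "(real^'n) set" assume fin: "hausdorff_outer k A < \<infinity>"
    let ?H = "hausdorff_outer k"
    define D where "D n = {x\<in>A. 1 / real (Suc n) \<le> infdist x F}" for n
    define R where "R n = D (Suc n) - D n" for n
    \<comment> \<open>Shells whose indices differ by at least 2 have positive distance, so the even-indexed and the
      odd-indexed shells each have total measure at most that of \<open>A\<close>; hence the tails tend to 0.\<close>
    have gap: "1 / real (Suc (Suc n)) < 1 / real (Suc n)" for n
      by (simp add: field_simps)
    have D: "?H (A \<inter> F) + ?H (D n) \<le> ?H A" for n
    proof -
      have "?H (A \<inter> F) + ?H (D n) \<le> ?H ((A \<inter> F) \<union> D n)"
      proof (rule hausdorff_outer_separated)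
        show "0 < 1 / real (Suc n)" by simp
        fix x y assume "x \<in> A \<inter> F" "y \<in> D n"
        then show "1 / real (Suc n) \<le> dist x y"
          using infdist_le[of x F y] by (auto simp: D_def dist_commute)
      qed
      also have "\<dots> \<le> ?H A" by (rule hausdorff_outer_mono) (auto simp: D_def)
      finally show ?thesis .
    qed
    have step: "(\<Sum>j<M. ?H (R (2 * j + c))) \<le> ?H (\<Union>j<M. R (2 * j + c))" for M c
    proof (induction M)
      case (Suc M)
      have sep: "?H (\<Union>j<M. R (2 * j + c)) + ?H (R (2 * M + c))
          \<le> ?H ((\<Union>j<M. R (2 * j + c)) \<union> R (2 * M + c))"
      proof (cases M)
        case (Suc m)
        \<comment> \<open>\<open>R n\<close> is the shell skipped between
          \<open>R (2 * m + c)\<close> and \<open>R (2 * M + c)\<close>; its width in terms of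
          \<open>infdist\<close> is the separating distance.\<close>
        define n where "n = 2 * m + c + 1"
        show ?thesis
        proof (rule hausdorff_outer_separated)
          show "0 < 1 / real (Suc n) - 1 / real (Suc (Suc n))" using gap[of n] by simp
          fix x y assume x: "x \<in> (\<Union>j<M. R (2 * j + c))" and y: "y \<in> R (2 * M + c)"
          from x obtain j where j: "j < M" "1 / real (Suc (Suc (2 * j + c))) \<le> infdist x F"
            by (auto simp: R_def D_def)
          have "1 / real (Suc n) \<le> 1 / real (Suc (Suc (2 * j + c)))"
            using j(1) Suc by (intro divide_left_mono) (auto simp: n_def)
          with j(2) have "1 / real (Suc n) \<le> infdist x F" by linarith
          moreover have "infdist y F < 1 / real (Suc (Suc n))"
            using y Suc by (auto simp: R_def D_def n_def)
          ultimately show "1 / real (Suc n) - 1 / real (Suc (Suc n)) \<le> dist x y"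
            using infdist_triangle[of x F y] by linarith
        qed
      qed simp
      have "(\<Sum>j<Suc M. ?H (R (2 * j + c))) \<le> ?H (\<Union>j<M. R (2 * j + c)) + ?H (R (2 * M + c))"
        using Suc by (simp add: add_right_mono)
      also note sep
      also have "(\<Union>j<M. R (2 * j + c)) \<union> R (2 * M + c) = (\<Union>j<Suc M. R (2 * j + c))"
        by (auto simp: lessThan_Suc)
      finally show ?case .
    qed simp
    have part: "(\<Sum>j<M. ?H (R (2 * j + c))) \<le> ?H A" for M c
      using step by (rule order_trans) (auto intro!: hausdorff_outer_mono simp: R_def D_def)
    have "(\<Sum>m<n. ?H (R m)) \<le> ?H A + ?H A" for n
    proof -
      have "(\<Sum>m<n. ?H (R m)) \<le> (\<Sum>m<2 * n. ?H (R m))"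
        by (rule sum_mono2) auto
      also have "\<dots> = (\<Sum>j<n. ?H (R (2 * j + 0))) + (\<Sum>j<n. ?H (R (2 * j + 1)))"
        by (induction n) (auto simp: algebra_simps)
      also have "\<dots> \<le> ?H A + ?H A" by (intro add_mono part)
      finally show ?thesis .
    qed
    then have "(\<Sum>m. ?H (R m)) \<le> ?H A + ?H A" by (intro suminf_le_const summableI) auto
    also have "\<dots> < \<infinity>" using fin by (simp add: ennreal_add_eq_top less_top)
    finally have sumfin: "(\<Sum>m. ?H (R m)) < \<infinity>" .
    define r where "r m = enn2real (?H (R m))" for m
    have r: "?H (R m) = ennreal (r m)" "0 \<le> r m" for m
      using ennreal_suminf_lessD[OF sumfin, of m] by (auto simp: r_def)
    have "summable r"
      using sumfin by (intro summable_suminf_not_top) (auto simp: r(1)[symmetric] r(2))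
    then have tail: "(\<lambda>n. \<Sum>m. r (m + n)) \<longlonglongrightarrow> 0" by (rule suminf_exist_split2)
    have cover: "?H (A - F) \<le> ?H (D n) + ennreal (\<Sum>m. r (m + n))" for n
    proof -
      have "A - F \<subseteq> D n \<union> (\<Union>m. R (m + n))"
      proof
        fix x assume x: "x \<in> A - F"
        have "infdist x F > 0" using x False F infdist_pos_not_in_closed by blast
        then obtain N0 where "inverse (real (Suc N0)) < infdist x F"
          using reals_Archimedean by blast
        then have ex: "x \<in> D N0" using x by (simp add: D_def inverse_eq_divide)
        define N where "N = (LEAST N. x \<in> D N)"
        have N: "x \<in> D N" "\<And>m. m < N \<Longrightarrow> x \<notin> D m"
          using ex unfolding N_def by (auto intro: LeastI dest: not_less_Least)
        show "x \<in> D n \<union> (\<Union>m. R (m + n))"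
        proof (cases "N \<le> n")
          case True
          have "1 / real (Suc n) \<le> 1 / real (Suc N)" using True by (intro divide_left_mono) auto
          then show ?thesis using N(1) by (auto simp: D_def)
        next
          case False
          then obtain m where "N = Suc (m + n)" by (metis add.commute less_imp_Suc_add not_le)
          then have "x \<in> R (m + n)" using N by (auto simp: R_def)
          then show ?thesis by blast
        qed
      qed
      then have "?H (A - F) \<le> ?H (D n \<union> (\<Union>m. R (m + n)))" by (rule hausdorff_outer_mono)
      also have "\<dots> \<le> ?H (D n) + ?H (\<Union>m. R (m + n))" by (rule hausdorff_outer_Un)
      also have "\<dots> \<le> ?H (D n) + (\<Sum>m. ?H (R (m + n)))"
        by (intro add_left_mono hausdorff_outer_UN)
      also have "(\<Sum>m. ?H (R (m + n))) = ennreal (\<Sum>m. r (m + n))"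
        unfolding r(1) by (rule suminf_ennreal2) (use r(2) \<open>summable r\<close> in \<open>auto simp: summable_iff_shift\<close>)
      finally show ?thesis .
    qed
    show "?H (A \<inter> F) + ?H (A - F) \<le> ?H A"
    proof (rule ennreal_le_epsilon)
      fix e :: real assume "0 < e"
      then obtain n where n: "(\<Sum>m. r (m + n)) < e"
        using order_tendstoD(2)[OF tail] by (meson eventually_sequentially order_refl)
      have "?H (A \<inter> F) + ?H (A - F) \<le> ?H (A \<inter> F) + (?H (D n) + ennreal (\<Sum>m. r (m + n)))"
        by (intro add_left_mono cover)
      also have "\<dots> = (?H (A \<inter> F) + ?H (D n)) + ennreal (\<Sum>m. r (m + n))"
        by (simp add: add.assoc)
      also have "\<dots> \<le> ?H A + ennreal e"
        using n by (intro add_mono D ennreal_leI) auto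
      finally show "?H (A \<inter> F) + ?H (A - F) \<le> ?H A + ennreal e" .
    qed
  qed
qed auto

lemma borel_subset_hausdorff: "sets borel \<subseteq> sets (hausdorff_measure k :: (real^'n::finite) measure)"
proof -
  have "sigma_sets UNIV (Collect closed) \<subseteq> sets (hausdorff_measure k :: (real^'n) measure)"
    using sets.sigma_sets_subset[of "Collect closed" "hausdorff_measure k :: (real^'n) measure"]
      closed_hausdorff_measurable by auto
  then show ?thesis by (simp add: borel_eq_closed)
qed

text \<open>Closing the sets of a cover changes neither diameters nor gauges. The intersection over
  \<open>n\<close> of the closed near-optimal covers of mesh \<open>1 / (n + 1)\<close> is therefore
  covered by each of them at no extra cost.\<close>

lemma hausdorff_borel_hull:
  assumes fin: "hausdorff_outer k A < \<infinity>"
  obtains B where "B \<in> sets borel" "A \<subseteq> B" "hausdorff_outer k B = hausdorff_outer k A"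
proof -
  let ?d = "\<lambda>n. inverse (real (Suc n))"
  have "\<exists>C. C \<in> fine_covers (?d n) A \<and> (\<Sum>i. hausdorff_gauge k (C i)) < hausdorff_outer k A + ?d n" for n
  proof -
    have "hausdorff_delta k (?d n) A \<le> hausdorff_outer k A" by (rule hausdorff_delta_le_outer) simp
    also have "\<dots> < hausdorff_outer k A + ?d n" using fin by (auto simp add: less_top)
    finally show ?thesis by (metis hausdorff_delta_less)
  qed
  then obtain C where C: "\<And>n. C n \<in> fine_covers (?d n) A"
    and Cl: "\<And>n. (\<Sum>i. hausdorff_gauge k (C n i)) < hausdorff_outer k A + ?d n"
    by metis
  define B where "B = (\<Inter>n. \<Union>i. closure (C n i))"
  have AB: "A \<subseteq> B"
  proof
    fix x assume "x \<in> A"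
    then have "x \<in> (\<Union>i. C n i)" for n using C[of n] by (auto simp: fine_covers_def)
    then have "x \<in> (\<Union>i. closure (C n i))" for n
      using UN_mono[of UNIV UNIV "C n" "\<lambda>i. closure (C n i)"] closure_subset by (meson order_refl subsetD)
    then show "x \<in> B" by (simp add: B_def)
  qed
  have "hausdorff_delta k \<delta> B \<le> hausdorff_outer k A" if pos: "0 < \<delta>" for \<delta>
  proof (rule ennreal_le_epsilon)
    fix e :: real assume e: "0 < e"
    obtain n where n: "?d n < min \<delta> e" using reals_Archimedean[of "min \<delta> e"] pos e by auto
    have "(\<lambda>i. closure (C n i)) \<in> fine_covers (?d n) B"
      using C[of n] by (auto simp: fine_covers_def B_def diameter_closure)
    then have "hausdorff_delta k (?d n) B \<le> (\<Sum>i. hausdorff_gauge k (closure (C n i)))"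
      by (rule hausdorff_delta_le)
    also have "\<dots> = (\<Sum>i. hausdorff_gauge k (C n i))"
      using C[of n] by (intro suminf_cong) (auto simp: fine_covers_def hausdorff_gauge_closure)
    also have "\<dots> \<le> hausdorff_outer k A + ?d n" using Cl by (rule less_imp_le)
    also have "\<dots> \<le> hausdorff_outer k A + e" using n by (intro add_left_mono ennreal_leI) auto
    finally have "hausdorff_delta k (?d n) B \<le> hausdorff_outer k A + e" .
    moreover have "hausdorff_delta k \<delta> B \<le> hausdorff_delta k (?d n) B"
      using n by (intro hausdorff_delta_antimono) auto
    ultimately show "hausdorff_delta k \<delta> B \<le> hausdorff_outer k A + e" by (rule order_trans[rotated])
  qed
  then have "hausdorff_outer k B \<le> hausdorff_outer k A"
    unfolding hausdorff_outer_def[of k B] by (intro SUP_least) auto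
  then have "hausdorff_outer k B = hausdorff_outer k A"
    using hausdorff_outer_mono[OF AB] by (rule antisym)
  moreover have "B \<in> sets borel" unfolding B_def by auto
  ultimately show ?thesis using AB that by blast
qed

text \<open>\<open>inner_regular\<close> needs a finite measure on the Borel sets. It is applied to
  the restriction \<open>N\<close> of the Hausdorff measure to a Borel hull \<open>B\<close> of
  \<open>S\<close>. Removing a Borel null set \<open>Z\<close> that contains \<open>B - S\<close>
  leaves a Borel subset of \<open>S\<close> of full measure.\<close>

lemma hausdorff_compact_approx:
  fixes S :: "(real^'n::finite) set"
  assumes S: "S \<in> sets (hausdorff_measure k)" and fin: "hausdorff_outer k S < \<infinity>" and e: "0 < e"
  obtains K where "compact K" "K \<subseteq> S" "hausdorff_outer k (S - K) < e"
proof -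
  let ?M = "hausdorff_measure k :: (real^'n) measure"
  have bor: "X \<in> sets ?M" if "X \<in> sets borel" for X using borel_subset_hausdorff that by blast
  obtain B where B: "B \<in> sets borel" "S \<subseteq> B" "hausdorff_outer k B = hausdorff_outer k S"
    using hausdorff_borel_hull[OF fin] by blast
  have "emeasure ?M (B - S) = 0"
    using B S fin bor by (subst emeasure_Diff) (auto simp: emeasure_hausdorff)
  then have BS: "hausdorff_outer k (B - S) = 0" using B S bor by (simp add: emeasure_hausdorff sets.Diff)
  then obtain Z where Z: "Z \<in> sets borel" "B - S \<subseteq> Z" "hausdorff_outer k Z = 0"
    using hausdorff_borel_hull[of k "B - S"] by auto
  define N where "N = measure_of UNIV (sets borel) (\<lambda>X. emeasure ?M (B \<inter> X))"
  have N: "emeasure N X = emeasure ?M (B \<inter> X)" if "X \<in> sets borel" for X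
    unfolding N_def
  proof (rule emeasure_measure_of_sigma)
    show "sigma_algebra UNIV (sets (borel :: (real^'n) measure))"
      using sets.sigma_algebra_axioms[of "borel :: (real^'n) measure"] by simp
    show "countably_additive (sets borel) (\<lambda>X. emeasure ?M (B \<inter> X))"
    proof (rule countably_additiveI)
      fix X :: "nat \<Rightarrow> (real^'n) set" assume X: "range X \<subseteq> sets borel" "disjoint_family X"
      have "(\<Sum>i. emeasure ?M (B \<inter> X i)) = emeasure ?M (\<Union>i. B \<inter> X i)"
        using X B(1)
        by (intro suminf_emeasure) (auto intro!: bor simp: disjoint_family_on_def image_subset_iff)
      then show "(\<Sum>i. emeasure ?M (B \<inter> X i)) = emeasure ?M (B \<inter> (\<Union>i. X i))" by simp
    qed
  qed (use that in \<open>auto simp: positive_def\<close>)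
  have setsN: "sets N = sets borel"
    using sets.sets_measure_of_eq[of "borel :: (real^'n) measure"] unfolding N_def by simp
  have BZ: "B - Z \<in> sets borel" using B Z by auto
  have eqS: "emeasure N (B - Z) = emeasure ?M S"
  proof (rule trans[OF N[OF BZ] antisym])
    show "emeasure ?M (B \<inter> (B - Z)) \<le> emeasure ?M S"
      using Z S by (intro emeasure_mono) auto
    have "emeasure ?M S \<le> emeasure ?M ((B \<inter> (B - Z)) \<union> Z)"
    proof (rule emeasure_mono)
      show "S \<subseteq> (B \<inter> (B - Z)) \<union> Z" using B(2) by blast
    qed (intro bor sets.Un sets.Int BZ B(1) Z(1))
    also have "\<dots> \<le> emeasure ?M (B \<inter> (B - Z)) + emeasure ?M Z"
      by (intro emeasure_subadditive bor sets.Int BZ B(1) Z(1))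
    also have "\<dots> = emeasure ?M (B \<inter> (B - Z))"
      by (simp add: emeasure_hausdorff[OF bor[OF Z(1)]] Z(3))
    finally show "emeasure ?M S \<le> emeasure ?M (B \<inter> (B - Z))" .
  qed
  have fN: "emeasure N (space N) \<noteq> \<infinity>"
  proof -
    have "emeasure N UNIV = hausdorff_outer k S" using B bor N[of UNIV] by (simp add: emeasure_hausdorff)
    moreover have "space N = UNIV" using setsN sets_eq_imp_space_eq[of N borel] by simp
    ultimately show ?thesis using fin by simp
  qed
  \<comment> \<open>\<open>ennreal_between\<close> can go strictly below a value only if that value
    is positive; for measure 0 the empty set does.\<close>
  have "\<exists>K\<in>{K. K \<subseteq> B - Z \<and> compact K}. emeasure N (B - Z) < emeasure N K + e"
  proof (cases "emeasure N (B - Z) = 0")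
    case True
    then show ?thesis using e by (intro bexI[of _ "{}"]) auto
  next
    case False
    have finBZ: "emeasure N (B - Z) < Orderings.top" using eqS fin S by (simp add: emeasure_hausdorff)
    then have "emeasure N (B - Z) - e < (SUP K\<in>{K. K \<subseteq> B - Z \<and> compact K}. emeasure N K)"
      unfolding inner_regular[OF setsN fN BZ, symmetric]
      using False e finBZ by (intro ennreal_between) (auto simp: zero_less_iff_neq_zero)
    then obtain K where K: "K \<subseteq> B - Z" "compact K" "emeasure N (B - Z) - e < emeasure N K"
      unfolding less_SUP_iff by auto
    \<comment> \<open>Subtraction in \<open>ennreal\<close> truncates at 0, so \<open>e\<close> can
      be moved across only if it does not exceed the measure; otherwise the claim is
      immediate.\<close>
    have "emeasure N (B - Z) < emeasure N K + e"
    proof (cases "e \<le> emeasure N (B - Z)")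
      case True
      then show ?thesis using minus_less_iff_ennreal[OF le_less_trans[OF True finBZ] True] K(3) by simp
    next
      case False
      then have "emeasure N (B - Z) < e" by simp
      also have "e \<le> emeasure N K + e" by simp
      finally show ?thesis .
    qed
    then show ?thesis using K by blast
  qed
  then obtain K where K: "K \<subseteq> B - Z" "compact K" "emeasure N (B - Z) < emeasure N K + e" by blast
  have KB: "K \<in> sets borel" using K(2) by (simp add: borel_compact)
  have KS: "K \<subseteq> S" using K Z by auto
  have "emeasure N K = hausdorff_outer k K"
    using N[OF KB] Int_absorb1[of K B] K(1) by (simp add: emeasure_hausdorff[OF bor[OF KB]] le_infI2 Diff_subset subset_trans)
  then have lt: "emeasure ?M S < emeasure ?M K + e" using K(3) eqS
    by (simp add: emeasure_hausdorff[OF bor[OF KB]])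
  have finK: "emeasure ?M K < Orderings.top" using le_less_trans[OF hausdorff_outer_mono[OF KS] fin]
    by (simp add: emeasure_hausdorff[OF bor[OF KB]])
  have "emeasure ?M (S - K) < e"
  proof (subst emeasure_Diff)
    have "emeasure ?M K \<le> emeasure ?M S" using KS S by (rule emeasure_mono)
    then show "emeasure ?M S - emeasure ?M K < e"
      using lt finK minus_less_iff_ennreal[of "emeasure ?M K" "emeasure ?M S" e] by (simp add: add.commute)
  qed (use finK KS S bor[OF KB] in auto)
  then have "hausdorff_outer k (S - K) < e" by (simp add: emeasure_hausdorff sets.Diff S bor[OF KB])
  then show ?thesis using K KS that by blast
qed

section \<open>Gram determinants as alternating forms\<close>

lemma det_orthonormal_rows:
  fixes a :: "nat \<Rightarrow> nat \<Rightarrow> real"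
  assumes "\<And>i j. i < k \<Longrightarrow> j < k \<Longrightarrow> (\<Sum>c<k. a i c * a j c) = (if i = j then 1 else 0)"
  shows "\<bar>Determinant.det (Matrix.mat k k (\<lambda>(i, j). a i j))\<bar> = 1"
proof -
  let ?A = "Matrix.mat k k (\<lambda>(i, j). a i j)"
  have "?A * transpose_mat ?A = 1\<^sub>m k"
    using assms
    by (intro eq_matI) (auto simp: scalar_prod_def atLeast0LessThan)
  then have "Determinant.det ?A * Determinant.det ?A = 1"
    by (metis Determinant.det_mult Determinant.det_one Determinant.det_transpose mat_carrier transpose_carrier_mat)
  then show ?thesis by (auto simp: square_eq_1_iff)
qed

text \<open>Hadamard's inequality. In the induction the first rows are already orthonormal and orthogonal
  to all others; the next row is replaced by the normalised vector of its cofactors, which does not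
  decrease the determinant and is orthogonal to the other rows.\<close>

lemma abs_det_le_1_aux:
  fixes a :: "nat \<Rightarrow> nat \<Rightarrow> real"
  assumes "m \<le> k" and "\<And>i. i < k \<Longrightarrow> (\<Sum>c<k. (a i c)\<^sup>2) \<le> 1"
    and "\<And>i j. i < k - m \<Longrightarrow> j < k \<Longrightarrow> (\<Sum>c<k. a i c * a j c) = (if i = j then 1 else 0)"
  shows "\<bar>Determinant.det (Matrix.mat k k (\<lambda>(i, j). a i j))\<bar> \<le> 1"
  using assms
proof (induction m arbitrary: a)
  case 0
  then show ?case using det_orthonormal_rows[of k a] by simp
next
  case (Suc m)
  \<comment> \<open>\<open>m\<close> counts the rows still to be treated, and \<open>r\<close> is
    the first of these.\<close>
  define r where "r = k - Suc m"
  have r: "r < k" "k - m = Suc r" using Suc.prems(1) by (auto simp: r_def)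
  let ?M = "\<lambda>a. Matrix.mat k k (\<lambda>(i, j). a i j)"
  define c where "c j = cofactor (?M a) r j" for j
  have cof: "cofactor (?M (a(r := u))) r j = c j" if "j < k" for u j
    unfolding c_def Determinant.cofactor_def mat_delete_def
    by (intro arg_cong2[where f="(*)"] arg_cong[where f=Determinant.det] eq_matI) auto
  have exp: "Determinant.det (?M (a(r := u))) = (\<Sum>j<k. u j * c j)" for u
    using laplace_expansion_row[of "?M (a(r := u))" k r] r cof by simp
  \<comment> \<open>The length of the cofactor vector of row \<open>r\<close>: Cauchy-Schwarz bounds
    the determinant by \<open>q\<close>, and the new row \<open>c / q\<close> attains exactly
    \<open>q\<close>.\<close>
  define q where "q = sqrt (\<Sum>j<k. (c j)\<^sup>2)"
  have deta: "Determinant.det (?M a) = (\<Sum>j<k. a r j * c j)"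
    using exp[of "a r"] by simp
  have le: "\<bar>Determinant.det (?M a)\<bar> \<le> q"
  proof -
    have "(\<Sum>j<k. a r j * c j)\<^sup>2 \<le> (\<Sum>j<k. (a r j)\<^sup>2) * (\<Sum>j<k. (c j)\<^sup>2)"
      by (rule Cauchy_Schwarz_ineq_sum)
    also have "\<dots> \<le> 1 * (\<Sum>j<k. (c j)\<^sup>2)"
      using Suc.prems(2)[OF r(1)] by (intro mult_right_mono sum_nonneg) auto
    finally show ?thesis unfolding deta q_def by (simp add: real_le_rsqrt)
  qed
  show ?case
  proof (cases "q = 0")
    case True
    then show ?thesis using le by simp
  next
    case False
    then have q: "q > 0" unfolding q_def by (smt (verit) real_sqrt_ge_zero sum_nonneg zero_le_power2)
    have qq: "(\<Sum>j<k. (c j)\<^sup>2) = q * q" unfolding q_def by (simp add: sum_nonneg)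
    define u where "u j = c j / q" for j
    \<comment> \<open>Pairing the cofactors of row \<open>r\<close> with row \<open>i\<close>
      computes the determinant of a matrix with two equal rows.\<close>
    have perp: "(\<Sum>j<k. a i j * c j) = 0" if "i < k" "i \<noteq> r" for i
    proof -
      have "Determinant.det (?M (a(r := a i))) = 0"
        by (rule Determinant.det_identical_rows[of _ k i r]) (use that r in \<open>auto intro!: eq_vecI\<close>)
      then show ?thesis using exp by simp
    qed
    have uu: "(\<Sum>j<k. u j * u j) = 1"
      using q qq by (simp add: u_def sum_divide_distrib[symmetric] power2_eq_square)
    have up: "(\<Sum>j<k. a i j * u j) = 0" "(\<Sum>j<k. u j * a i j) = 0" if "i < k" "i \<noteq> r" for i
      using perp[OF that] q
      by (simp_all add: u_def sum_divide_distrib[symmetric] mult.commute)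
    have "\<bar>Determinant.det (?M (a(r := u)))\<bar> \<le> 1"
    proof (rule Suc.IH)
      show "m \<le> k" using Suc.prems by simp
      show "(\<Sum>c<k. ((a(r := u)) i c)\<^sup>2) \<le> 1" if "i < k" for i
        using Suc.prems(2)[OF that] uu by (auto simp: power2_eq_square)
      show "(\<Sum>c<k. (a(r := u)) i c * (a(r := u)) j c) = (if i = j then 1 else 0)"
        if "i < k - m" "j < k" for i j
        using Suc.prems(3)[of i j] Suc.prems(3)[of j i] that uu up[of i] up[of j] r
        by (cases "i = r"; cases "j = r") (auto simp: r_def)
    qed
    moreover have "Determinant.det (?M (a(r := u))) = q"
      unfolding exp u_def using qq q by (simp add: sum_divide_distrib[symmetric] power2_eq_square)
    ultimately show ?thesis using le by simp
  qed
qed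

lemma abs_det_le_1:
  fixes a :: "nat \<Rightarrow> nat \<Rightarrow> real"
  assumes "\<And>i. i < k \<Longrightarrow> (\<Sum>c<k. (a i c)\<^sup>2) \<le> 1"
  shows "\<bar>Determinant.det (Matrix.mat k k (\<lambda>(i, j). a i j))\<bar> \<le> 1"
  using abs_det_le_1_aux[of k k a] assms by simp

section \<open>Covectors dual to frames\<close>

lemma Bessel_finite:
  fixes w :: "nat \<Rightarrow> 'a::real_inner"
  assumes w: "\<And>i j. i < k \<Longrightarrow> j < k \<Longrightarrow> w i \<bullet> w j = (if i = j then 1 else 0)"
  shows "(\<Sum>c<k. (u \<bullet> w c)\<^sup>2) \<le> (norm u)\<^sup>2"
proof -
  define p where "p = (\<Sum>c<k. (u \<bullet> w c) *\<^sub>R w c)"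
  have "p \<bullet> w c = u \<bullet> w c" if "c < k" for c
  proof -
    have "p \<bullet> w c = (\<Sum>d<k. (u \<bullet> w d) * (if d = c then 1 else 0))"
      unfolding p_def inner_sum_left using w that by (intro sum.cong) auto
    then show ?thesis using that by (simp add: if_distrib cong: if_cong)
  qed
  then have pp: "p \<bullet> p = (\<Sum>c<k. (u \<bullet> w c)\<^sup>2)"
    by (subst (2) p_def) (simp add: inner_sum_right power2_eq_square)
  have up: "u \<bullet> p = (\<Sum>c<k. (u \<bullet> w c)\<^sup>2)"
    unfolding p_def inner_sum_right by (simp add: power2_eq_square)
  have "0 \<le> (u - p) \<bullet> (u - p)" by simp
  then show ?thesis using pp up
    by (simp add: inner_diff_left inner_diff_right inner_commute[of p u] power2_norm_eq_inner)
qed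

text \<open>For \<open>v\<close> orthonormal this is the covector dual to \<open>v 0 \<and> \<dots> \<and> v (k - 1)\<close>.\<close>

definition gram_form :: "nat \<Rightarrow> (nat \<Rightarrow> real^'n::finite) \<Rightarrow> 'n covector" where
  "gram_form k v w = Determinant.det (Matrix.mat k k (\<lambda>(i, j). v i \<bullet> w j))"

text \<open>Exhibits a polynomial in inner products, from which continuity in \<open>v\<close> is
  immediate.\<close>

lemma gram_form_expand:
  "gram_form k v w =
     (\<Sum>p\<in>{p. p permutes {0..<k}}. signof p * (\<Prod>i = 0..<k. v i \<bullet> w (p i)))"
proof -
  have "gram_form k v w = (\<Sum>p\<in>{p. p permutes {0..<k}}. signof p *
      (\<Prod>i = 0..<k. Matrix.mat k k (\<lambda>(i, j). v i \<bullet> w j) $$ (i, p i)))"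
    unfolding gram_form_def by (rule det_def') simp
  moreover have "p i < k" if "p permutes {0..<k}" "i < k" for p i
    using permutes_in_image[OF that(1), of i] that(2) by simp
  ultimately show ?thesis by simp
qed

lemma alt_form_gram_form:
  fixes v :: "nat \<Rightarrow> real^'n"
  shows "alt_form k (gram_form k v)"
  unfolding alt_form_def
proof (intro conjI allI impI)
  fix w w' :: "nat \<Rightarrow> real^'n" assume "\<forall>i<k. w i = w' i"
  then show "gram_form k v w = gram_form k v w'"
    unfolding gram_form_def by (intro arg_cong[where f=Determinant.det] eq_matI) auto
next
  fix i w assume i: "i < k"
  let ?M = "\<lambda>w. Matrix.mat k k (\<lambda>(i, j). v i \<bullet> w j)"
  \<comment> \<open>The cofactors of column \<open>i\<close> do not involve \<open>w i\<close>, so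
    Laplace expansion along this column is linear in that vector.\<close>
  have cof: "cofactor (?M (w(i := u))) j i = cofactor (?M w) j i" if "j < k" for u j
    unfolding Determinant.cofactor_def mat_delete_def
    by (intro arg_cong2[where f="(*)"] arg_cong[where f=Determinant.det] eq_matI) auto
  have "gram_form k v (w(i := u)) = (\<Sum>j<k. (v j \<bullet> u) * cofactor (?M w) j i)" for u
    unfolding gram_form_def
    using laplace_expansion_column[of "?M (w(i := u))" k i] i cof by simp
  then show "linear (\<lambda>u. gram_form k v (w(i := u)))"
    by (auto intro!: linearI simp: inner_add_right algebra_simps sum.distrib sum_distrib_left)
next
  fix w :: "nat \<Rightarrow> real^'n" and i j assume "i < k \<and> j < k \<and> i \<noteq> j \<and> w i = w j"
  then show "gram_form k v w = 0"
    unfolding gram_form_def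
    by (intro det_identical_columns[of _ k i j]) (auto intro!: eq_vecI)
qed

text \<open>Row \<open>i\<close> lists the coefficients of \<open>v i\<close> in an orthonormal
  system, so Bessel bounds its length by 1 and Hadamard applies. Only the lengths of the
  \<open>v i\<close> are restricted, since extended frames are no longer orthonormal.\<close>

lemma abs_gram_form_le_1:
  assumes "\<And>i. i < k \<Longrightarrow> norm (v i) \<le> 1"
    and "\<And>i j. i < k \<Longrightarrow> j < k \<Longrightarrow> w i \<bullet> w j = (if i = j then 1 else 0)"
  shows "\<bar>gram_form k v w\<bar> \<le> 1"
  unfolding gram_form_def
proof (rule abs_det_le_1)
  fix i assume "i < k"
  have "(\<Sum>c<k. (v i \<bullet> w c)\<^sup>2) \<le> (norm (v i))\<^sup>2"
    by (rule Bessel_finite[OF assms(2)])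
  also have "\<dots> \<le> 1" using assms(1)[OF \<open>i < k\<close>] by (simp add: power_le_one)
  finally show "(\<Sum>c<k. (v i \<bullet> w c)\<^sup>2) \<le> 1" .
qed

lemma gram_form_orthonormal:
  assumes "\<And>i j. i < k \<Longrightarrow> j < k \<Longrightarrow> v i \<bullet> v j = (if i = j then 1 else 0)"
  shows "gram_form k v v = 1"
proof -
  have "Matrix.mat k k (\<lambda>(i, j). v i \<bullet> v j) = 1\<^sub>m k"
    using assms by (intro eq_matI) auto
  then show ?thesis by (simp add: gram_form_def)
qed

lemma continuous_on_gram_form:
  assumes "\<And>i. i < k \<Longrightarrow> continuous_on E (\<lambda>x. v x i)"
  shows "continuous_on E (\<lambda>x. gram_form k (v x) w)"
  unfolding gram_form_expand using assms by (intro continuous_intros) auto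

section \<open>Lusin's theorem for orientations\<close>

text \<open>Approximating \<open>S \<inter> A n\<close> and \<open>S - A n\<close> from inside by
  compact \<open>P n\<close> and \<open>Q n\<close> and keeping only their union makes
  \<open>A n\<close> relatively clopen. Intersecting over \<open>n\<close> achieves this for all
  \<open>A n\<close> at once.\<close>

lemma lusin_sets:
  fixes S :: "(real^'n::finite) set" and A :: "nat \<Rightarrow> (real^'n) set"
  assumes S: "S \<in> sets (hausdorff_measure k)" and fin: "hausdorff_outer k S < \<infinity>"
    and A: "\<And>n. A n \<in> sets (hausdorff_measure k)" and e: "0 < e"
  obtains K where "compact K" "K \<subseteq> S" "hausdorff_outer k (S - K) \<le> ennreal e"
    "\<And>n. closed (K \<inter> A n)" "\<And>n. closed (K - A n)"
proof -
  \<comment> \<open>The final halving shares stage \<open>n\<close> between \<open>P n\<close> and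
    \<open>Q n\<close>; the stages sum to \<open>e\<close> by
    \<open>power_half_series\<close>.\<close>
  let ?e = "\<lambda>n. e * (1/2) ^ Suc n / 2"
  have epos: "0 < ennreal (?e n)" for n using e by simp
  have sub: "hausdorff_outer k X < \<infinity>" if "X \<subseteq> S" for X
    using hausdorff_outer_mono[OF that] fin by (rule le_less_trans)
  have "\<exists>P. compact P \<and> P \<subseteq> S \<inter> A n \<and> hausdorff_outer k (S \<inter> A n - P) < ?e n" for n
    by (rule hausdorff_compact_approx[OF sets.Int[OF S A] sub epos, of n n]) auto
  then obtain P where P: "\<And>n. compact (P n)" "\<And>n. P n \<subseteq> S \<inter> A n"
      "\<And>n. hausdorff_outer k (S \<inter> A n - P n) < ?e n" by metis
  have "\<exists>Q. compact Q \<and> Q \<subseteq> S - A n \<and> hausdorff_outer k (S - A n - Q) < ?e n" for n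
    by (rule hausdorff_compact_approx[OF sets.Diff[OF S A] sub epos, of n n]) auto
  then obtain Q where Q: "\<And>n. compact (Q n)" "\<And>n. Q n \<subseteq> S - A n"
      "\<And>n. hausdorff_outer k (S - A n - Q n) < ?e n" by metis
  define K where "K = (\<Inter>n. P n \<union> Q n)"
  have clK: "closed K" unfolding K_def
    by (intro closed_INT ballI closed_Un compact_imp_closed P(1) Q(1))
  have "K \<subseteq> P 0 \<union> Q 0" by (auto simp: K_def)
  then have "K = (P 0 \<union> Q 0) \<inter> K" by blast
  then have comp: "compact K" using clK P(1)[of 0] Q(1)[of 0] by (metis compact_Int_closed compact_Un)
  have KS: "K \<subseteq> S" using \<open>K \<subseteq> P 0 \<union> Q 0\<close> P(2)[of 0] Q(2)[of 0] by blast
  have "S - K \<subseteq> (\<Union>n. (S \<inter> A n - P n) \<union> (S - A n - Q n))" by (auto simp: K_def)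
  then have "hausdorff_outer k (S - K) \<le> hausdorff_outer k (\<Union>n. (S \<inter> A n - P n) \<union> (S - A n - Q n))"
    by (rule hausdorff_outer_mono)
  also have "\<dots> \<le> (\<Sum>n. hausdorff_outer k ((S \<inter> A n - P n) \<union> (S - A n - Q n)))"
    by (rule hausdorff_outer_UN)
  also have "\<dots> \<le> (\<Sum>n. ennreal (e * (1/2) ^ Suc n))"
  proof (rule suminf_le)
    fix n
    have "hausdorff_outer k ((S \<inter> A n - P n) \<union> (S - A n - Q n)) \<le> ennreal (?e n) + ennreal (?e n)"
      by (rule order_trans[OF hausdorff_outer_Un]) (intro add_mono less_imp_le P(3) Q(3))
    also have "\<dots> = ennreal (e * (1/2) ^ Suc n)"
      using e by (simp flip: ennreal_plus)
    finally show "hausdorff_outer k ((S \<inter> A n - P n) \<union> (S - A n - Q n)) \<le> ennreal (e * (1/2) ^ Suc n)" .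
  qed auto
  also have "\<dots> = ennreal e"
    using e sums_mult[OF power_half_series, of e]
    by (intro suminf_ennreal_eq) auto
  finally have "hausdorff_outer k (S - K) \<le> ennreal e" .
  moreover have "K \<inter> A n = K \<inter> P n" "K - A n = K \<inter> Q n" for n
  proof -
    have "K \<subseteq> P n \<union> Q n" by (auto simp: K_def)
    then show "K \<inter> A n = K \<inter> P n" "K - A n = K \<inter> Q n" using P(2)[of n] Q(2)[of n] by blast+
  qed
  then have "closed (K \<inter> A n)" "closed (K - A n)" for n
    using clK P(1) Q(1) by (auto intro!: closed_Int compact_imp_closed)
  ultimately show ?thesis using that comp KS by blast
qed

text \<open>The sets \<open>A n\<close> enumerate the preimages of a countable basis under all
  \<open>f m\<close> together, so a single \<open>K\<close> serves the whole sequence. Such a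
  preimage is relatively open in \<open>K\<close> because \<open>K - A n\<close> is closed.\<close>

lemma lusin:
  fixes S :: "(real^'n::finite) set"
    and f :: "nat \<Rightarrow> real^'n \<Rightarrow> 'b::second_countable_topology"
  assumes S: "S \<in> sets (hausdorff_measure k)" and fin: "hausdorff_outer k S < \<infinity>"
    and f: "\<And>m. f m \<in> borel_measurable (restrict_space (hausdorff_measure k) S)" and e: "0 < e"
  obtains K where "compact K" "K \<subseteq> S" "hausdorff_outer k (S - K) \<le> ennreal e"
    "\<And>m. continuous_on K (f m)"
proof -
  obtain \<B> :: "'b set set" where \<B>: "countable \<B>" "topological_basis \<B>"
    using ex_countable_basis by blast
  have ne: "\<B> \<noteq> {}"
  proof
    assume "\<B> = {}"
    then have "\<forall>U :: 'b set. open U \<longrightarrow> U = {}" using \<B>(2) unfolding topological_basis_def by auto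
    then show False using open_UNIV by blast
  qed
  define A where "A n = S \<inter> f (fst (prod_decode n)) -` from_nat_into \<B> (snd (prod_decode n))" for n
  have A: "A n \<in> sets (hausdorff_measure k)" for n
  proof -
    have "open (from_nat_into \<B> (snd (prod_decode n)))"
      using \<B>(2) from_nat_into[OF ne] by (rule topological_basis_open)
    then have "f (fst (prod_decode n)) -` from_nat_into \<B> (snd (prod_decode n))
        \<inter> space (restrict_space (hausdorff_measure k) S) \<in> sets (restrict_space (hausdorff_measure k) S)"
      by (intro measurable_sets[OF f]) auto
    then show ?thesis
      using S by (auto simp: A_def sets_restrict_space_iff space_restrict_space Int_commute)
  qed
  obtain K where K: "compact K" "K \<subseteq> S" "hausdorff_outer k (S - K) \<le> ennreal e"
    "\<And>n. closed (K \<inter> A n)" "\<And>n. closed (K - A n)"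
    using lusin_sets[where A=A, OF S fin A e] by metis
  have "continuous_on K (f m)" for m
    unfolding continuous_on_open_invariant
  proof (intro allI impI)
    fix U :: "'b set" assume "open U"
    then have "\<exists>\<U>\<subseteq>\<B>. \<Union>\<U> = U" using \<B>(2) by (simp add: topological_basis_def)
    then obtain \<U> where \<U>: "\<U> \<subseteq> \<B>" "\<Union>\<U> = U" by blast
    have "\<exists>G. open G \<and> G \<inter> K = f m -` u \<inter> K" if u: "u \<in> \<U>" for u
    proof -
      obtain j where j: "from_nat_into \<B> j = u"
        using from_nat_into_surj[OF \<B>(1), of u] u \<U>(1) by blast
      have "A (prod_encode (m, j)) = S \<inter> f m -` u" by (simp add: A_def j)
      then have "- (K - A (prod_encode (m, j))) \<inter> K = f m -` u \<inter> K" using K(2) by blast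
      moreover have "open (- (K - A (prod_encode (m, j))))" by (rule open_Compl[OF K(5)])
      ultimately show ?thesis by metis
    qed
    then obtain G where G: "\<And>u. u \<in> \<U> \<Longrightarrow> open (G u)" "\<And>u. u \<in> \<U> \<Longrightarrow> G u \<inter> K = f m -` u \<inter> K"
      by metis
    show "\<exists>G. open G \<and> G \<inter> K = f m -` U \<inter> K"
    proof (intro exI conjI)
      show "open (\<Union>u\<in>\<U>. G u)" using G(1) by blast
      have "(\<Union>u\<in>\<U>. G u) \<inter> K = (\<Union>u\<in>\<U>. G u \<inter> K)" by blast
      also have "\<dots> = (\<Union>u\<in>\<U>. f m -` u \<inter> K)" using G(2) by simp
      also have "\<dots> = f m -` U \<inter> K" using \<U>(2) by blast
      finally show "(\<Union>u\<in>\<U>. G u) \<inter> K = f m -` U \<inter> K" .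
    qed
  qed
  then show ?thesis using K that by blast
qed

section \<open>Compact pieces with continuous orientation\<close>

definition orthonormal_frame :: "nat \<Rightarrow> (nat \<Rightarrow> real^'n::finite) \<Rightarrow> bool" where
  "orthonormal_frame k w \<longleftrightarrow> (\<forall>i<k. \<forall>j<k. w i \<bullet> w j = (if i = j then 1 else 0))"

lemma orthonormal_frame_norm: "orthonormal_frame k w \<Longrightarrow> i < k \<Longrightarrow> norm (w i) = 1"
  by (simp add: orthonormal_frame_def norm_eq_sqrt_inner)

lemma orientation_AE:
  "orientation k S \<sigma> v \<Longrightarrow>
     AE x in hausdorff_measure k. x \<in> S \<longrightarrow> (\<sigma> x = 1 \<or> \<sigma> x = -1) \<and> orthonormal_frame k (v x)"
  unfolding orientation_def orthonormal_frame_def by auto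

text \<open>In contrast to \<open>orientation\<close>, the sign and frame conditions hold at every
  point; the exceptional null set has been cut away.\<close>

definition framed_compact ::
  "nat \<Rightarrow> (real^'n::finite \<Rightarrow> real) \<Rightarrow> (real^'n \<Rightarrow> nat \<Rightarrow> real^'n) \<Rightarrow> (real^'n) set \<Rightarrow> bool" where
  "framed_compact k \<sigma> v K \<longleftrightarrow> compact K \<and> continuous_on K \<sigma> \<and>
     (\<forall>i<k. continuous_on K (\<lambda>x. v x i)) \<and>
     (\<forall>x\<in>K. (\<sigma> x = 1 \<or> \<sigma> x = -1) \<and> orthonormal_frame k (v x))"

lemma framed_compactD:
  assumes "framed_compact k \<sigma> v K"
  shows "compact K" "continuous_on K \<sigma>" "\<And>i. i < k \<Longrightarrow> continuous_on K (\<lambda>x. v x i)"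
    "\<And>x. x \<in> K \<Longrightarrow> \<sigma> x = 1 \<or> \<sigma> x = -1" "\<And>x. x \<in> K \<Longrightarrow> orthonormal_frame k (v x)"
  using assms unfolding framed_compact_def by blast+

lemma orientation_compact_approx:
  fixes S :: "(real^'n::finite) set"
  assumes or: "orientation k S \<sigma> v" and X: "X \<in> sets (hausdorff_measure k)" "X \<subseteq> S"
    and fin: "hausdorff_outer k X < \<infinity>" and e: "0 < e"
  obtains K where "framed_compact k \<sigma> v K" "K \<subseteq> X" "hausdorff_outer k (X - K) \<le> ennreal e"
proof -
  let ?M = "hausdorff_measure k :: (real^'n) measure"
  from orientation_AE[OF or] obtain N where N: "N \<in> null_sets ?M"
    "\<And>x. x \<in> S \<Longrightarrow> x \<notin> N \<Longrightarrow> (\<sigma> x = 1 \<or> \<sigma> x = -1) \<and> orthonormal_frame k (v x)"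
    by (elim AE_E3) auto
  define Y where "Y = X - N"
  have Y: "Y \<in> sets ?M" "Y \<subseteq> S" using X N by (auto simp: Y_def)
  have finY: "hausdorff_outer k Y < \<infinity>"
    using hausdorff_outer_mono[of Y X k] fin by (auto simp: Y_def intro: le_less_trans)
  define f :: "nat \<Rightarrow> real^'n \<Rightarrow> real^'n"
    where "f m x = (case m of 0 \<Rightarrow> \<chi> i. \<sigma> x | Suc i \<Rightarrow> if i < k then v x i else 0)" for m x
  have \<sigma>: "\<sigma> \<in> borel_measurable (restrict_space ?M Y)"
    and v: "\<And>i. i < k \<Longrightarrow> (\<lambda>x. v x i) \<in> borel_measurable (restrict_space ?M Y)"
    using or Y unfolding orientation_def by (auto intro: measurable_restrict_mono)
  have "f m \<in> borel_measurable (restrict_space ?M Y)" for m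
  proof (cases m)
    case 0
    then have "f m = (\<lambda>x. \<sigma> x *\<^sub>R (\<chi> i. 1))" by (auto simp: f_def fun_eq_iff Finite_Cartesian_Product.vec_eq_iff)
    then show ?thesis using \<sigma> by simp
  next
    case (Suc i)
    then show ?thesis using v by (cases "i < k") (auto simp: f_def[abs_def])
  qed
  then obtain K where K: "compact K" "K \<subseteq> Y" "hausdorff_outer k (Y - K) \<le> ennreal e"
    "\<And>m. continuous_on K (f m)"
    using lusin[OF Y(1) finY _ e] by blast
  have "hausdorff_outer k (X - K) \<le> hausdorff_outer k ((Y - K) \<union> N)"
    by (rule hausdorff_outer_mono) (auto simp: Y_def)
  also have "\<dots> \<le> hausdorff_outer k (Y - K) + hausdorff_outer k N" by (rule hausdorff_outer_Un)
  also have "hausdorff_outer k N = 0" using N(1) by (auto simp: null_sets_def emeasure_hausdorff)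
  finally have "hausdorff_outer k (X - K) \<le> ennreal e" using K(3) by (simp add: order_trans)
  moreover have "continuous_on K \<sigma>"
  proof -
    have "continuous_on K (\<lambda>x. f 0 x $ i)" for i by (intro continuous_intros K)
    then show ?thesis by (simp add: f_def)
  qed
  moreover have "continuous_on K (\<lambda>x. v x i)" if "i < k" for i
    using K(4)[of "Suc i"] that by (simp add: f_def[abs_def])
  moreover have "K \<subseteq> X" "(\<sigma> x = 1 \<or> \<sigma> x = -1) \<and> orthonormal_frame k (v x)" if "x \<in> K" for x
    using K(2) N(2)[of x] X(2) that by (auto simp: Y_def)
  moreover have "K \<subseteq> X" using K(2) by (auto simp: Y_def)
  ultimately show ?thesis using that[of K] K(1) unfolding framed_compact_def by blast
qed

section \<open>Forms and averaging currents\<close>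

text \<open>\<open>D0\<close> controls \<open>\<omega> x u\<close> only for a fixed argument
  \<open>u\<close>. Expanding one slot in the standard basis replaces a varying vector by fixed
  ones; the next lemmas do this slot by slot.\<close>

lemma alt_form_slot:
  fixes \<phi> :: "('n::finite) covector"
  assumes "alt_form k \<phi>" "m < k"
  shows "\<phi> (u(m := y)) = (\<Sum>c\<in>UNIV. y $ c * \<phi> (u(m := axis c 1)))"
proof -
  have lin: "linear (\<lambda>y. \<phi> (u(m := y)))" using assms by (auto simp: alt_form_def)
  have "y = (\<Sum>c\<in>UNIV. (y $ c) *\<^sub>R axis c 1)"
    using basis_expansion[of y] by (simp add: scalar_mult_eq_scaleR)
  then have "\<phi> (u(m := y)) = \<phi> (u(m := (\<Sum>c\<in>UNIV. (y $ c) *\<^sub>R axis c 1)))" by simp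
  also have "\<dots> = (\<Sum>c\<in>UNIV. y $ c * \<phi> (u(m := axis c 1)))"
    by (subst linear_sum[OF lin]) (simp add: linear_scale[OF lin])
  finally show ?thesis .
qed

text \<open>Induction on the number \<open>m\<close> of slots holding arbitrary vectors of length at
  most 1, the others being fixed by \<open>u\<close>. For \<open>m = 0\<close> compactness of
  \<open>E\<close> gives the bound, and each further slot costs a finite sum of earlier
  bounds.\<close>

lemma D0_bounded:
  fixes E :: "(real^'n::finite) set"
  assumes E: "compact E" and \<omega>: "\<omega> \<in> D0 k E"
  obtains B where "0 \<le> B" "\<And>x w. orthonormal_frame k w \<Longrightarrow> \<bar>\<omega> x w\<bar> \<le> B"
proof -
  have alt: "alt_form k (\<omega> x)" if "x \<in> E" for x using \<omega> that by (auto simp: D0_def)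
  have "\<exists>B. \<forall>x\<in>E. \<forall>w. (\<forall>i<m. norm (w i) \<le> 1) \<longrightarrow> \<bar>\<omega> x (\<lambda>a. if a < m then w a else u a)\<bar> \<le> B"
    if "m \<le> k" for m and u :: "nat \<Rightarrow> real^'n" using that
  proof (induction m arbitrary: u)
    case 0
    have "continuous_on E (\<lambda>x. \<omega> x u)" using \<omega> by (auto simp: D0_def)
    then have "bounded ((\<lambda>x. \<omega> x u) ` E)" using E by (intro compact_imp_bounded compact_continuous_image)
    then show ?case by (auto simp: bounded_iff)
  next
    case (Suc m)
    then have "\<exists>B. \<forall>x\<in>E. \<forall>w. (\<forall>i<m. norm (w i) \<le> 1) \<longrightarrow>
        \<bar>\<omega> x (\<lambda>a. if a < m then w a else (u(m := axis c 1)) a)\<bar> \<le> B" for c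
      by auto
    then obtain B where B: "\<And>c x w. x \<in> E \<Longrightarrow> \<forall>i<m. norm (w i) \<le> 1 \<Longrightarrow>
        \<bar>\<omega> x (\<lambda>a. if a < m then w a else (u(m := axis c 1)) a)\<bar> \<le> B c" by metis
    show ?case
    proof (intro exI ballI allI impI)
      fix x and w :: "nat \<Rightarrow> real^'n"
      assume x: "x \<in> E" and w: "\<forall>i<Suc m. norm (w i) \<le> 1"
      let ?u = "\<lambda>a. if a < m then w a else u a"
      have eq: "(\<lambda>a. if a < Suc m then w a else u a) = ?u(m := w m)"
        "?u(m := axis c 1) = (\<lambda>a. if a < m then w a else (u(m := axis c 1)) a)" for c
        by (auto simp: fun_eq_iff less_Suc_eq)
      have "\<bar>\<omega> x (?u(m := w m))\<bar> \<le> (\<Sum>c\<in>UNIV. \<bar>w m $ c * \<omega> x (?u(m := axis c 1))\<bar>)"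
        using alt_form_slot[OF alt[OF x], of m ?u "w m"] Suc.prems by (simp add: sum_abs)
      also have "\<dots> \<le> (\<Sum>c\<in>UNIV. 1 * B c)"
        unfolding abs_mult eq(2)
      proof (intro sum_mono mult_mono B x)
        show "\<bar>w m $ c\<bar> \<le> 1" for c using component_le_norm_cart[of "w m" c] w by (meson lessI order_trans)
      qed (use w in auto)
      finally show "\<bar>\<omega> x (\<lambda>a. if a < Suc m then w a else u a)\<bar> \<le> (\<Sum>c\<in>UNIV. 1 * B c)"
        unfolding eq .
    qed
  qed
  from this[of k "\<lambda>_. 0"] obtain B where B: "\<And>x w. x \<in> E \<Longrightarrow> \<forall>i<k. norm (w i) \<le> 1 \<Longrightarrow>
      \<bar>\<omega> x (\<lambda>a. if a < k then w a else 0)\<bar> \<le> B" by auto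
  have "\<bar>\<omega> x w\<bar> \<le> max B 0" if w: "orthonormal_frame k w" for x w
  proof (cases "x \<in> E")
    case True
    have "\<omega> x w = \<omega> x (\<lambda>a. if a < k then w a else 0)"
      using alt[OF True] unfolding alt_form_def by simp
    then show ?thesis using B[OF True, of w] orthonormal_frame_norm[OF w] by simp
  next
    case False
    then show ?thesis using \<omega> by (auto simp: D0_def)
  qed
  then show ?thesis using that[of "max B 0"] by auto
qed

text \<open>The induction of \<open>D0_bounded\<close> again: the base case is continuity,
  transferred from Borel to Hausdorff-measurable sets, and a slot filled with \<open>v x m\<close>
  becomes a finite sum of products of measurable functions.\<close>

lemma D0_measurable:
  fixes E :: "(real^'n::finite) set"
  assumes \<omega>: "\<omega> \<in> D0 k E" and S: "S \<subseteq> E"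
    and v: "\<And>i. i < k \<Longrightarrow> (\<lambda>x. v x i) \<in> borel_measurable (restrict_space (hausdorff_measure k) S)"
  shows "(\<lambda>x. \<omega> x (v x)) \<in> borel_measurable (restrict_space (hausdorff_measure k) S)"
proof -
  let ?R = "restrict_space (hausdorff_measure k) S"
  have alt: "alt_form k (\<omega> x)" if "x \<in> E" for x using \<omega> that by (auto simp: D0_def)
  have sp: "space ?R = S" by (simp add: space_restrict_space)
  have "(\<lambda>x. \<omega> x (\<lambda>a. if a < m then v x a else u a)) \<in> borel_measurable ?R" if "m \<le> k" for m and u :: "nat \<Rightarrow> real^'n"
    using that
  proof (induction m arbitrary: u)
    case 0
    have "continuous_on S (\<lambda>x. \<omega> x u)" using \<omega> S by (auto simp: D0_def intro: continuous_on_subset)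
    then have "(\<lambda>x. \<omega> x u) \<in> borel_measurable (restrict_space borel S)"
      by (rule borel_measurable_continuous_on_restrict)
    moreover have "sets (restrict_space borel S) \<subseteq> sets ?R"
      using borel_subset_hausdorff by (auto simp: sets_restrict_space)
    ultimately show ?case
      by (auto simp: measurable_def space_restrict_space)
  next
    case (Suc m)
    have "(\<lambda>x. \<Sum>c\<in>UNIV. v x m $ c * \<omega> x (\<lambda>a. if a < m then v x a else (u(m := axis c 1)) a))
        \<in> borel_measurable ?R"
      using Suc.prems v[of m]
      by (intro borel_measurable_sum borel_measurable_times Suc.IH) (auto simp: cart_eq_inner_axis)
    also have "?this \<longleftrightarrow> ?case"
    proof (rule measurable_cong)
      fix x assume "x \<in> space ?R"
      then have x: "x \<in> E" using S sp by auto
      let ?u = "\<lambda>a. if a < m then v x a else u a"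
      have eq: "(\<lambda>a. if a < Suc m then v x a else u a) = ?u(m := v x m)"
        "?u(m := axis c 1) = (\<lambda>a. if a < m then v x a else (u(m := axis c 1)) a)" for c
        by (auto simp: fun_eq_iff less_Suc_eq)
      show "(\<Sum>c\<in>UNIV. v x m $ c * \<omega> x (\<lambda>a. if a < m then v x a else (u(m := axis c 1)) a))
          = \<omega> x (\<lambda>a. if a < Suc m then v x a else u a)"
        unfolding eq(1) using alt_form_slot[OF alt[OF x], of m ?u "v x m"] Suc.prems
        by (simp add: eq(2))
    qed
    finally show ?case .
  qed
  from this[of k "\<lambda>_. 0"]
  have "(\<lambda>x. \<omega> x (\<lambda>a. if a < k then v x a else 0)) \<in> borel_measurable ?R" by simp
  also have "?this \<longleftrightarrow> ?thesis"
  proof (rule measurable_cong)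
    fix x assume "x \<in> space ?R"
    then have "alt_form k (\<omega> x)" using S sp alt by auto
    then show "\<omega> x (\<lambda>a. if a < k then v x a else 0) = \<omega> x (v x)"
      unfolding alt_form_def by simp
  qed
  finally show ?thesis .
qed

section \<open>Averages of forms over oriented sets\<close>

lemma admissibleD:
  assumes "admissible k E S \<sigma> v"
  shows "S \<subseteq> E" "S \<in> sets (hausdorff_measure k)" "orientation k S \<sigma> v"
    "emeasure (hausdorff_measure k) S < \<infinity>" "0 < measure (hausdorff_measure k) S"
    "enn2real (hausdorff_outer k S) = measure (hausdorff_measure k) S"
    "hausdorff_outer k S < \<infinity>"
  using assms
  by (auto simp: admissible_def k_rectifiable_def emeasure_hausdorff measure_def enn2real_positive_iff
      less_top)

lemma form_integrable:
  assumes E: "compact E" and \<omega>: "\<omega> \<in> D0 k E" and ad: "admissible k E S \<sigma> v"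
  shows "set_integrable (hausdorff_measure k) S (\<lambda>x. \<sigma> x * \<omega> x (v x))"
proof -
  let ?M = "hausdorff_measure k :: (real^'a) measure"
  note ad' = admissibleD[OF ad]
  obtain B where B: "0 \<le> B" "\<And>x w. orthonormal_frame k w \<Longrightarrow> \<bar>\<omega> x w\<bar> \<le> B"
    using D0_bounded[OF E \<omega>] by metis
  have "(\<lambda>x. \<sigma> x * \<omega> x (v x)) \<in> borel_measurable (restrict_space ?M S)"
    using ad'(3) unfolding orientation_def
    by (intro borel_measurable_times D0_measurable[OF \<omega> ad'(1)]) auto
  then have meas: "(\<lambda>x. indicator S x *\<^sub>R (\<sigma> x * \<omega> x (v x))) \<in> borel_measurable ?M"
    using ad'(2) by (subst borel_measurable_restrict_space_iff[symmetric]) auto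
  show ?thesis unfolding set_integrable_def
  proof (rule integrableI_bounded_set[where A=S and B=B])
    show "AE x in ?M. x \<in> S \<longrightarrow> norm (indicator S x *\<^sub>R (\<sigma> x * \<omega> x (v x))) \<le> B"
      using orientation_AE[OF ad'(3)] by eventually_elim (use B in \<open>auto simp: abs_mult\<close>)
  qed (use ad' meas in auto)
qed

text \<open>The integrand equals \<open>t\<close> on \<open>K\<close>, vanishes off
  \<open>X\<close>, and on \<open>X - K\<close> differs from \<open>t\<close> by at most
  \<open>2 * B\<close>. It is used with \<open>X = S \<inter> A\<close> for supports and with
  \<open>X = S\<close> for prescribed averages.\<close>

lemma form_integral_estimate:
  assumes E: "compact E" and \<omega>: "\<omega> \<in> D0 k E" and ad: "admissible k E S \<sigma> v"
    and X: "X \<in> sets (hausdorff_measure k)" "X \<subseteq> S"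
    and K: "K \<in> sets (hausdorff_measure k)" "K \<subseteq> X"
    and on: "\<And>x. x \<in> K \<Longrightarrow> \<sigma> x * \<omega> x (v x) = t"
    and off: "\<And>x. x \<in> S - X \<Longrightarrow> \<omega> x (v x) = 0"
    and B: "\<And>x w. orthonormal_frame k w \<Longrightarrow> \<bar>\<omega> x w\<bar> \<le> B" and t: "\<bar>t\<bar> \<le> B"
  shows "\<bar>form_integral k S \<sigma> v \<omega> - t * measure (hausdorff_measure k) X\<bar>
    \<le> 2 * B * measure (hausdorff_measure k) (X - K)"
proof -
  let ?M = "hausdorff_measure k :: (real^'a) measure"
  let ?f = "\<lambda>x. indicator S x *\<^sub>R (\<sigma> x * \<omega> x (v x))"
  note ad' = admissibleD[OF ad]
  have finX: "emeasure ?M Y < \<infinity>" if "Y \<subseteq> X" for Y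
    using emeasure_mono[of Y S ?M] that X(2) ad'(2,4) by (auto intro: le_less_trans)
  have int: "integrable ?M ?f" using form_integrable[OF E \<omega> ad] by (simp add: set_integrable_def)
  have intX: "integrable ?M (\<lambda>x. indicat_real X x * t)" using finX[of X] X by auto
  have intXK: "integrable ?M (\<lambda>x. 2 * B * indicat_real (X - K) x)" using finX[of "X - K"] X K by auto
  have "form_integral k S \<sigma> v \<omega> - t * measure ?M X = (\<integral>x. ?f x - indicat_real X x * t \<partial>?M)"
    using int intX X finX[of X]
    by (subst Bochner_Integration.integral_diff) (auto simp: form_integral_def set_lebesgue_integral_def)
  also have "\<bar>\<dots>\<bar> \<le> (\<integral>x. \<bar>?f x - indicat_real X x * t\<bar> \<partial>?M)" by (rule integral_abs_bound)
  also have "\<dots> \<le> (\<integral>x. 2 * B * indicat_real (X - K) x \<partial>?M)"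
  proof (rule integral_mono_AE)
    show "AE x in ?M. \<bar>?f x - indicat_real X x * t\<bar> \<le> 2 * B * indicat_real (X - K) x"
      using orientation_AE[OF ad'(3)]
    proof eventually_elim
      fix x assume x: "x \<in> S \<longrightarrow> (\<sigma> x = 1 \<or> \<sigma> x = -1) \<and> orthonormal_frame k (v x)"
      consider "x \<notin> S" | "x \<in> S - X" | "x \<in> K" | "x \<in> X - K" by blast
      then show "\<bar>?f x - indicat_real X x * t\<bar> \<le> 2 * B * indicat_real (X - K) x"
      proof cases
        case 4
        then have "\<bar>\<sigma> x * \<omega> x (v x)\<bar> \<le> B" using x B[of "v x" x] X(2) by (auto simp: abs_mult)
        then have "\<bar>\<sigma> x * \<omega> x (v x) - t\<bar> \<le> 2 * B" using t by linarith
        then show ?thesis using 4 X(2) by (auto simp: indicator_def)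
      qed (use X K on off in \<open>auto simp: indicator_def\<close>)
    qed
  qed (use int intX intXK in auto)
  also have "\<dots> = 2 * B * measure ?M (X - K)" using X K finX[of "X - K"] by simp
  finally show ?thesis .
qed

text \<open>The passage from pointwise bounds to the norm: almost everywhere on \<open>S\<close> the
  form is evaluated on an orthonormal frame.\<close>

lemma avg_current_bound:
  assumes E: "compact E" and \<omega>: "\<omega> \<in> D0 k E" and ad: "admissible k E S \<sigma> v"
    and B: "0 \<le> B" "\<And>x w. orthonormal_frame k w \<Longrightarrow> \<bar>\<omega> x w\<bar> \<le> B"
  shows "\<bar>avg_current k S \<sigma> v \<omega>\<bar> \<le> B"
proof -
  let ?M = "hausdorff_measure k :: (real^'a) measure"
  let ?f = "\<lambda>x. indicator S x *\<^sub>R (\<sigma> x * \<omega> x (v x))"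
  note ad' = admissibleD[OF ad]
  have int: "integrable ?M ?f" using form_integrable[OF E \<omega> ad] by (simp add: set_integrable_def)
  have "\<bar>form_integral k S \<sigma> v \<omega>\<bar> \<le> (\<integral>x. \<bar>?f x\<bar> \<partial>?M)"
    unfolding form_integral_def set_lebesgue_integral_def by (rule integral_abs_bound)
  also have "\<dots> \<le> (\<integral>x. B * indicat_real S x \<partial>?M)"
  proof (rule integral_mono_AE)
    show "AE x in ?M. \<bar>?f x\<bar> \<le> B * indicat_real S x"
      using orientation_AE[OF ad'(3)]
      by eventually_elim (use B(2) in \<open>auto simp: abs_mult indicator_def\<close>)
  qed (use int ad' in auto)
  also have "\<dots> = B * measure ?M S" using ad' by simp
  finally show ?thesis using ad'(5,6) by (simp add: avg_current_def divide_le_eq)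
qed

lemma averaging_currents_bound:
  assumes "compact E" "\<omega> \<in> D0 k E" "T \<in> averaging_currents k E"
    and "0 \<le> B" "\<And>x w. orthonormal_frame k w \<Longrightarrow> \<bar>\<omega> x w\<bar> \<le> B"
  shows "\<bar>T \<omega>\<bar> \<le> B"
  using assms avg_current_bound unfolding averaging_currents_def by blast

section \<open>The norm as a supremum over averaging currents\<close>

lemma norm0_eq: "norm0 k E \<omega> = (SUP T\<in>averaging_currents k E. \<bar>T \<omega>\<bar>)"
proof -
  have "{\<bar>avg_current k S \<sigma> v \<omega>\<bar> | S \<sigma> v. admissible k E S \<sigma> v} = (\<lambda>T. \<bar>T \<omega>\<bar>) ` averaging_currents k E"
    unfolding averaging_currents_def by blast
  then show ?thesis unfolding norm0_def by simp
qed

lemma abs_le_norm0: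
  assumes E: "compact E" and \<omega>: "\<omega> \<in> D0 k E" and T: "T \<in> averaging_currents k E"
  shows "\<bar>T \<omega>\<bar> \<le> norm0 k E \<omega>"
proof -
  obtain B where B: "0 \<le> B" "\<And>x w. orthonormal_frame k w \<Longrightarrow> \<bar>\<omega> x w\<bar> \<le> B"
    using D0_bounded[OF E \<omega>] by metis
  have "bdd_above ((\<lambda>T. \<bar>T \<omega>\<bar>) ` averaging_currents k E)"
    using averaging_currents_bound[OF E \<omega> _ B] by (intro bdd_aboveI2) auto
  then show ?thesis unfolding norm0_eq using T by (intro cSUP_upper)
qed

lemma norm0_le:
  assumes "averaging_currents k E \<noteq> {}" "\<And>T. T \<in> averaging_currents k E \<Longrightarrow> \<bar>T \<omega>\<bar> \<le> B"
  shows "norm0 k E \<omega> \<le> B"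
  unfolding norm0_eq using assms by (rule cSUP_least)

lemma alt_form_sum:
  fixes \<phi> :: "nat \<Rightarrow> ('n::finite) covector"
  assumes "\<And>i. i < N \<Longrightarrow> alt_form k (\<phi> i)"
  shows "alt_form k (\<lambda>w. \<Sum>i<N. c i * \<phi> i w)"
  unfolding alt_form_def
proof (intro conjI allI impI)
  fix v w :: "nat \<Rightarrow> real^'n" assume "\<forall>i<k. v i = w i"
  then show "(\<Sum>i<N. c i * \<phi> i v) = (\<Sum>i<N. c i * \<phi> i w)"
    using assms by (intro sum.cong) (auto simp: alt_form_def)
next
  fix i and v :: "nat \<Rightarrow> real^'n" assume "i < k"
  then have lin: "linear (\<lambda>u. \<phi> j (v(i := u)))" if "j < N" for j
    using assms[OF that] by (auto simp: alt_form_def)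
  have "linear (\<lambda>u. c j * \<phi> j (v(i := u)))" if "j < N" for j
    using linear_compose_scale_right[OF lin[OF that], of "c j"] by (simp only: real_scaleR_def)
  then show "linear (\<lambda>u. \<Sum>j<N. c j * \<phi> j (v(i := u)))"
    by (intro linear_compose_sum ballI) (simp only: lessThan_iff)
next
  fix v :: "nat \<Rightarrow> real^'n" and i j assume "i < k \<and> j < k \<and> i \<noteq> j \<and> v i = v j"
  then have "\<phi> l v = 0" if "l < N" for l using assms[OF that] unfolding alt_form_def by blast
  then show "(\<Sum>l<N. c l * \<phi> l v) = 0" by simp
qed

lemma lin_comb_D0:
  assumes "\<And>i. i < N \<Longrightarrow> b i \<in> D0 k E"
  shows "lin_comb N c b \<in> D0 k E"
proof -
  have "continuous_on E (\<lambda>x. \<Sum>i<N. c i * b i x w)" for w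
    using assms by (intro continuous_intros) (auto simp: D0_def)
  moreover have "alt_form k (\<lambda>w. \<Sum>i<N. c i * b i x w)" if "x \<in> E" for x
    using assms that by (intro alt_form_sum) (auto simp: D0_def)
  moreover have "(\<lambda>w. \<Sum>i<N. c i * b i x w) = (\<lambda>_. 0)" if "x \<notin> E" for x
    using assms that by (auto simp: D0_def)
  ultimately show ?thesis by (auto simp: D0_def lin_comb_def)
qed

lemma averaging_current_lin_comb:
  assumes E: "compact E" and b: "\<And>i. i < N \<Longrightarrow> b i \<in> D0 k E" and T: "T \<in> averaging_currents k E"
  shows "T (lin_comb N c b) = (\<Sum>i<N. c i * T (b i))"
proof -
  obtain S \<sigma> v where S: "T = avg_current k S \<sigma> v" "admissible k E S \<sigma> v"
    using T unfolding averaging_currents_def by blast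
  let ?M = "hausdorff_measure k :: (real^'a) measure"
  have int: "integrable ?M (\<lambda>x. indicator S x *\<^sub>R (\<sigma> x * b i x (v x)))" if "i < N" for i
    using form_integrable[OF E b[OF that] S(2)] by (simp add: set_integrable_def)
  have "form_integral k S \<sigma> v (lin_comb N c b)
      = (\<integral>x. (\<Sum>i<N. c i * (indicator S x *\<^sub>R (\<sigma> x * b i x (v x)))) \<partial>?M)"
    unfolding form_integral_def set_lebesgue_integral_def lin_comb_def
    by (intro Bochner_Integration.integral_cong) (auto simp: sum_distrib_left algebra_simps)
  also have "\<dots> = (\<Sum>i<N. c i * form_integral k S \<sigma> v (b i))"
    using int by (subst Bochner_Integration.integral_sum)
      (auto simp: form_integral_def set_lebesgue_integral_def)
  finally show ?thesis by (simp add: S(1) avg_current_def sum_divide_distrib)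
qed

text \<open>\<open>lin_comb 1\<close> serves as scalar multiplication, so that the closure and
  linearity lemmas for \<open>lin_comb\<close> also cover normalisation.\<close>

lemma averaging_current_scale:
  assumes "compact E" "\<omega> \<in> D0 k E" "T \<in> averaging_currents k E"
  shows "T (lin_comb 1 (\<lambda>_. a) (\<lambda>_. \<omega>)) = a * T \<omega>"
  using averaging_current_lin_comb[of E 1 "\<lambda>_. \<omega>" k T "\<lambda>_. a"] assms by simp

lemma norm0_scale:
  assumes E: "compact E" and \<omega>: "\<omega> \<in> D0 k E" and ne: "averaging_currents k E \<noteq> {}"
    and a: "0 < a"
  shows "norm0 k E (lin_comb 1 (\<lambda>_. a) (\<lambda>_. \<omega>)) = a * norm0 k E \<omega>"
proof -
  let ?\<eta> = "lin_comb 1 (\<lambda>_. a) (\<lambda>_. \<omega>)"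
  have T: "\<bar>T ?\<eta>\<bar> = a * \<bar>T \<omega>\<bar>" if "T \<in> averaging_currents k E" for T
    using averaging_current_scale[OF E \<omega> that] a by (simp add: abs_mult)
  show ?thesis
  proof (rule antisym)
    show "norm0 k E ?\<eta> \<le> a * norm0 k E \<omega>"
      using T abs_le_norm0[OF E \<omega>] a by (intro norm0_le[OF ne]) (auto intro: mult_left_mono)
    have "?\<eta> \<in> D0 k E" using \<omega> by (rule lin_comb_D0)
    then have "\<bar>T \<omega>\<bar> \<le> norm0 k E ?\<eta> / a" if "T \<in> averaging_currents k E" for T
      using abs_le_norm0[OF E _ that, of ?\<eta>] T[OF that] a by (simp add: pos_le_divide_eq mult.commute)
    then have "norm0 k E \<omega> \<le> norm0 k E ?\<eta> / a" by (rule norm0_le[OF ne])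
    then show "a * norm0 k E \<omega> \<le> norm0 k E ?\<eta>" using a by (simp add: pos_le_divide_eq mult.commute)
  qed
qed

text \<open>Weight and frame vectors are extended separately, each within its unit ball, and
  recombined by the Gram determinant. The bound 1 on orthonormal frames survives because
  \<open>abs_gram_form_le_1\<close> asks only for short vectors.\<close>

lemma frame_form_extension:
  fixes E C :: "(real^'n::finite) set"
  assumes C: "closed C" and s: "continuous_on C s" "\<And>x. x \<in> C \<Longrightarrow> \<bar>s x\<bar> \<le> 1"
    and u: "\<And>i. i < k \<Longrightarrow> continuous_on C (\<lambda>x. u x i)"
      "\<And>x i. x \<in> C \<Longrightarrow> i < k \<Longrightarrow> norm (u x i) \<le> 1"
  obtains \<omega> where "\<omega> \<in> D0 k E" "\<And>x w. orthonormal_frame k w \<Longrightarrow> \<bar>\<omega> x w\<bar> \<le> 1"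
    "\<And>x. x \<in> C \<inter> E \<Longrightarrow> \<omega> x = (\<lambda>w. s x * gram_form k (u x) w)"
proof -
  have cl: "closedin (top_of_set UNIV) C" using C by simp
  obtain s' :: "real^'n \<Rightarrow> real" where s': "continuous_on UNIV s'" "\<And>x. x \<in> C \<Longrightarrow> s' x = s x" "\<And>x. \<bar>s' x\<bar> \<le> 1"
    using Tietze[OF s(1) cl, of 1] s(2) by auto
  have "\<exists>g. continuous_on UNIV g \<and> (\<forall>x\<in>C. g x = u x i) \<and> (\<forall>x. norm (g x) \<le> 1)" if "i < k" for i
    using Tietze[OF u(1)[OF that] cl, of 1] u(2)[OF _ that] by (metis UNIV_I zero_le_one)
  then obtain g where g: "\<And>i. i < k \<Longrightarrow> continuous_on UNIV (g i)"
    "\<And>i x. i < k \<Longrightarrow> x \<in> C \<Longrightarrow> g i x = u x i" "\<And>i x. i < k \<Longrightarrow> norm (g i x) \<le> 1" by metis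
  define \<omega> where "\<omega> x = (if x \<in> E then (\<lambda>w. s' x * gram_form k (\<lambda>i. g i x) w) else (\<lambda>_. 0))" for x
  have "alt_form k (\<lambda>w. s' x * gram_form k (\<lambda>i. g i x) w)" for x
    using alt_form_sum[of "Suc 0" k "\<lambda>_. gram_form k (\<lambda>i. g i x)" "\<lambda>_. s' x", OF alt_form_gram_form]
    by (simp add: lessThan_Suc)
  moreover have "continuous_on E (\<lambda>x. \<omega> x w)" for w
  proof -
    have "continuous_on E (\<lambda>x. s' x * gram_form k (\<lambda>i. g i x) w)"
      using s'(1) g(1)
      by (intro continuous_on_mult continuous_on_gram_form) (auto intro: continuous_on_subset)
    then show ?thesis by (rule continuous_on_eq) (simp add: \<omega>_def)
  qed
  ultimately have "\<omega> \<in> D0 k E" by (auto simp: D0_def \<omega>_def)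
  moreover have "\<bar>\<omega> x w\<bar> \<le> 1" if "orthonormal_frame k w" for x w
  proof -
    have "\<bar>gram_form k (\<lambda>i. g i x) w\<bar> \<le> 1"
      using that g(3) by (intro abs_gram_form_le_1) (auto simp: orthonormal_frame_def)
    then have "\<bar>s' x\<bar> * \<bar>gram_form k (\<lambda>i. g i x) w\<bar> \<le> 1 * 1" by (intro mult_mono s'(3)) auto
    then show ?thesis by (simp add: \<omega>_def abs_mult)
  qed
  moreover have "\<omega> x = (\<lambda>w. s x * gram_form k (u x) w)" if "x \<in> C \<inter> E" for x
  proof -
    have "gram_form k (\<lambda>i. g i x) = gram_form k (u x)"
      using g(2) that unfolding gram_form_def
      by (intro ext arg_cong[where f=Determinant.det] eq_matI) auto
    then show ?thesis using that s'(2) by (simp add: \<omega>_def)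
  qed
  ultimately show ?thesis using that by blast
qed

section \<open>Forms with prescribed averages\<close>

lemma avg_current_support_null:
  fixes E :: "(real^'n::finite) set"
  assumes E: "compact E" and ad: "admissible k E S \<sigma> v" and A: "open A"
    and van: "\<And>\<omega>. \<omega> \<in> D0 k E \<Longrightarrow> closure {x. \<omega> x \<noteq> (\<lambda>_. 0)} \<subseteq> A \<Longrightarrow> avg_current k S \<sigma> v \<omega> = 0"
  shows "S \<inter> A \<in> null_sets (hausdorff_measure k)"
proof -
  let ?M = "hausdorff_measure k :: (real^'n) measure"
  note ad' = admissibleD[OF ad]
  let ?X = "S \<inter> A"
  have bor: "Y \<in> sets borel \<Longrightarrow> Y \<in> sets ?M" for Y using borel_subset_hausdorff by blast
  have X: "?X \<in> sets ?M" using A by (intro sets.Int[OF ad'(2)] bor) auto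
  have finX: "hausdorff_outer k ?X < \<infinity>"
    using hausdorff_outer_mono[of ?X S k] ad'(7) by (auto intro: le_less_trans)
  \<comment> \<open>Otherwise the covector dual to the orientation on a large compact part of \<open>S \<inter> A\<close> extends to a
    form supported in \<open>A\<close> with non-zero average.\<close>
  have "measure ?M ?X = 0"
  proof (rule ccontr)
    define m where "m = measure ?M ?X"
    assume "measure ?M ?X \<noteq> 0"
    then have m: "m > 0" unfolding m_def using measure_nonneg[of ?M ?X] by linarith
    \<comment> \<open>With \<open>m / 4\<close> the estimate below gives an error of at most
      \<open>m / 2\<close>, too small to cancel the main term \<open>m\<close>.\<close>
    obtain K where fr: "framed_compact k \<sigma> v K" and K: "K \<subseteq> ?X" "hausdorff_outer k (?X - K) \<le> ennreal (m / 4)"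
      using orientation_compact_approx[OF ad'(3) X _ finX, of "m / 4"] m by (metis Int_lower1 divide_pos_pos zero_less_numeral)
    note fr' = framed_compactD[OF fr]
    have Ks: "K \<in> sets ?M" using fr'(1) by (intro bor borel_compact)
    \<comment> \<open>\<open>W\<close> forces \<open>closure U\<close> into \<open>A\<close>;
      prescribing 0 off \<open>U\<close> then puts the support of the form inside
      \<open>A\<close>.\<close>
    obtain U W where U: "open U" "open W" "K \<subseteq> U" "- A \<subseteq> W" "U \<inter> W = {}"
    proof (rule separation_normal[of K "- A"])
      show "closed K" "closed (- A)" using fr'(1) A by (auto intro: compact_imp_closed)
      show "K \<inter> - A = {}" using K(1) by blast
    qed
    have "closure U \<subseteq> - W" using U(2,5) by (intro closure_minimal) (auto simp: closed_Compl)
    then have clU: "closure U \<subseteq> A" using U(4) by blast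
    define C where "C = K \<union> - U"
    have KU: "K \<inter> - U = {}" using U(3) by blast
    have glue: "continuous_on C (\<lambda>x. if x \<in> K then h x else 0)" if "continuous_on K h"
      for h :: "real^'n \<Rightarrow> 'b::real_normed_vector"
      unfolding C_def
    proof (rule continuous_on_closed_Un)
      show "continuous_on K (\<lambda>x. if x \<in> K then h x else 0)"
        using that by (rule continuous_on_eq) simp
      show "continuous_on (- U) (\<lambda>x. if x \<in> K then h x else 0)"
        using continuous_on_const[of "- U" 0] by (rule continuous_on_eq) (use KU in auto)
    qed (use fr'(1) U(1) in \<open>auto intro: compact_imp_closed\<close>)
    have clC: "closed C" unfolding C_def using fr'(1) U(1) by (auto intro: compact_imp_closed)
    obtain \<omega> where \<omega>: "\<omega> \<in> D0 k E" "\<And>x w. orthonormal_frame k w \<Longrightarrow> \<bar>\<omega> x w\<bar> \<le> 1"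
      "\<And>x. x \<in> C \<inter> E \<Longrightarrow> \<omega> x = (\<lambda>w. (if x \<in> K then \<sigma> x else 0) * gram_form k (\<lambda>i. if x \<in> K then v x i else 0) w)"
    proof (rule frame_form_extension[OF clC glue[OF fr'(2)], of k "\<lambda>x i. if x \<in> K then v x i else 0" E])
      show "\<bar>if x \<in> K then \<sigma> x else 0\<bar> \<le> 1" if "x \<in> C" for x
        using fr'(4)[of x] by auto
      show "norm (if x \<in> K then v x i else 0) \<le> 1" if "x \<in> C" "i < k" for x i
        using orthonormal_frame_norm[OF fr'(5), of x i] that by auto
    qed (use glue[OF fr'(3)] in auto)
    \<comment> \<open>It is the zero weight that makes the form vanish here: for
      \<open>k = 0\<close> the Gram determinant is 1 whatever the frame.\<close>
    have out: "\<omega> x = (\<lambda>_. 0)" if "x \<notin> U" for x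
    proof (cases "x \<in> E")
      case True
      then show ?thesis using \<omega>(3)[of x] that KU by (auto simp: C_def)
    next
      case False
      then show ?thesis using \<omega>(1) by (simp add: D0_def)
    qed
    then have "closure {x. \<omega> x \<noteq> (\<lambda>_. 0)} \<subseteq> closure U" by (intro closure_mono) auto
    then have "avg_current k S \<sigma> v \<omega> = 0" using van[OF \<omega>(1)] clU by blast
    then have "form_integral k S \<sigma> v \<omega> = 0"
      using ad'(5,6) by (simp add: avg_current_def)
    moreover have "\<bar>form_integral k S \<sigma> v \<omega> - 1 * measure ?M ?X\<bar> \<le> 2 * 1 * measure ?M (?X - K)"
    proof (rule form_integral_estimate[OF E \<omega>(1) ad X _ Ks K(1)])
      show "\<sigma> x * \<omega> x (v x) = 1" if "x \<in> K" for x
      proof -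
        have "\<omega> x = (\<lambda>w. \<sigma> x * gram_form k (v x) w)"
          using \<omega>(3)[of x] that K(1) ad'(1) by (auto simp: C_def)
        moreover have "gram_form k (v x) (v x) = 1"
          using fr'(5)[OF that] by (intro gram_form_orthonormal) (simp add: orthonormal_frame_def)
        ultimately show ?thesis using fr'(4)[OF that] by auto
      qed
      show "\<omega> x (v x) = 0" if "x \<in> S - ?X" for x
      proof -
        have "x \<notin> U" using that clU closure_subset by blast
        then show ?thesis using out by simp
      qed
    qed (use \<omega>(2) in auto)
    moreover have "measure ?M (?X - K) \<le> m / 4"
    proof -
      have "emeasure ?M (?X - K) \<le> ennreal (m / 4)"
        using K(2) emeasure_hausdorff[OF sets.Diff[OF X Ks]] by simp
      then show ?thesis unfolding measure_def
        by (rule enn2real_leI[rotated]) (use m in simp)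
    qed
    ultimately show False using m by (simp add: m_def)
  qed
  moreover have "emeasure ?M ?X = ennreal (measure ?M ?X)"
    using finX by (intro emeasure_eq_ennreal_measure) (simp add: emeasure_hausdorff[OF X])
  ultimately show ?thesis using X by (simp add: null_setsI)
qed

text \<open>The complement of the support is an uncountable union of open sets; Lindelof's theorem
  reduces it to a countable one, for which null sets add up.\<close>

lemma carrier_minus_support_null:
  fixes E :: "(real^'n::finite) set"
  assumes E: "compact E" and ad: "admissible k E S \<sigma> v"
  shows "hausdorff_outer k (S - current_support k E (avg_current k S \<sigma> v)) = 0"
proof -
  let ?M = "hausdorff_measure k :: (real^'n) measure"
  define \<A> where "\<A> = {A. open A \<and>
      (\<forall>\<omega>\<in>D0 k E. closure {x. \<omega> x \<noteq> (\<lambda>_. 0)} \<subseteq> A \<longrightarrow> avg_current k S \<sigma> v \<omega> = 0)}"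
  obtain \<A>' where \<A>': "\<A>' \<subseteq> \<A>" "countable \<A>'" "\<Union>\<A>' = \<Union>\<A>"
    using Lindelof[of \<A>] unfolding \<A>_def by auto
  have "(\<Union>A\<in>\<A>'. S \<inter> A) \<in> null_sets ?M"
  proof (rule null_sets_UN'[OF \<A>'(2)])
    fix A assume "A \<in> \<A>'"
    then have "A \<in> \<A>" using \<A>'(1) by blast
    then show "S \<inter> A \<in> null_sets ?M"
      by (intro avg_current_support_null[OF E ad]) (auto simp: \<A>_def)
  qed
  moreover have "S - current_support k E (avg_current k S \<sigma> v) = (\<Union>A\<in>\<A>'. S \<inter> A)"
    using admissibleD(1)[OF ad] \<A>'(3) unfolding current_support_def \<A>_def[symmetric] by blast
  ultimately show ?thesis by (auto simp: null_sets_def emeasure_hausdorff)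
qed

lemma carriers_Int_null:
  fixes E :: "(real^'n::finite) set"
  assumes E: "compact E" and ad: "admissible k E S \<sigma> v" "admissible k E S' \<sigma>' v'"
    and null: "hausdorff_outer k (current_support k E (avg_current k S \<sigma> v)
      \<inter> current_support k E (avg_current k S' \<sigma>' v')) = 0"
  shows "hausdorff_outer k (S \<inter> S') = 0"
proof -
  let ?s = "current_support k E (avg_current k S \<sigma> v)"
  let ?s' = "current_support k E (avg_current k S' \<sigma>' v')"
  have "hausdorff_outer k (S \<inter> S') \<le> hausdorff_outer k ((S - ?s) \<union> ((S' - ?s') \<union> (?s \<inter> ?s')))"
    by (rule hausdorff_outer_mono) blast
  also have "\<dots> \<le> hausdorff_outer k (S - ?s) + (hausdorff_outer k (S' - ?s') + hausdorff_outer k (?s \<inter> ?s'))"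
    by (rule order_trans[OF hausdorff_outer_Un add_left_mono[OF hausdorff_outer_Un]])
  also have "\<dots> = 0" using carrier_minus_support_null[OF E] ad null by simp
  finally show ?thesis by simp
qed

lemma exists_form_prescribed_averages:
  fixes E :: "(real^'n::finite) set" and N :: nat
  assumes E: "compact E" and ad: "\<And>i. i < N \<Longrightarrow> admissible k E (S i) (\<sigma> i) (v i)"
    and null: "\<And>i j. i < N \<Longrightarrow> j < N \<Longrightarrow> i \<noteq> j \<Longrightarrow> hausdorff_outer k (S i \<inter> S j) = 0"
    and t: "\<And>i. i < N \<Longrightarrow> \<bar>t i\<bar> \<le> 1" and e: "0 < e"
  obtains \<omega> where "\<omega> \<in> D0 k E" "\<And>x w. orthonormal_frame k w \<Longrightarrow> \<bar>\<omega> x w\<bar> \<le> 1"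
    "\<And>i. i < N \<Longrightarrow> \<bar>avg_current k (S i) (\<sigma> i) (v i) \<omega> - t i\<bar> \<le> e"
proof -
  let ?M = "hausdorff_measure k :: (real^'n) measure"
  note ad' = admissibleD[OF ad]
  \<comment> \<open>Removing the overlaps costs a null set and makes the compact pieces
    \<open>K i\<close> disjoint, so that different orientations and targets can be glued.\<close>
  define X where "X i = S i - (\<Union>j\<in>{..<N} - {i}. S j)" for i
  \<comment> \<open>The estimate doubles this error and the average divides it by
    \<open>measure ?M (S i)\<close>, which leaves \<open>e\<close>.\<close>
  define d where "d i = e * measure ?M (S i) / 2" for i
  have d: "0 < d i" if "i < N" for i using ad'(5)[OF that] e by (simp add: d_def)
  have "(\<Union>j\<in>{..<N} - {i}. S j) \<in> sets ?M" for i
    by (rule sets.finite_UN) (use ad'(2) in auto)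
  then have X: "X i \<in> sets ?M" "X i \<subseteq> S i" if "i < N" for i
    using that unfolding X_def by (auto intro!: sets.Diff ad'(2))
  have SX: "S i - X i \<in> null_sets ?M" if "i < N" for i
  proof -
    have "(\<Union>j\<in>{..<N} - {i}. S i \<inter> S j) \<in> null_sets ?M"
      using null that by (intro null_sets_UN' hausdorff_null_sets) auto
    moreover have "S i - X i = (\<Union>j\<in>{..<N} - {i}. S i \<inter> S j)" by (auto simp: X_def)
    ultimately show ?thesis by simp
  qed
  have "\<exists>K. framed_compact k (\<sigma> i) (v i) K \<and> K \<subseteq> X i \<and> hausdorff_outer k (X i - K) \<le> ennreal (d i)"
    if i: "i < N" for i
  proof -
    have fin: "hausdorff_outer k (X i) < \<infinity>"
      using hausdorff_outer_mono[OF X(2)[OF i], of k] ad'(7)[OF i] by (rule le_less_trans)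
    show ?thesis
      by (rule orientation_compact_approx[OF ad'(3)[OF i] X(1)[OF i] X(2)[OF i] fin d[OF i]]) blast
  qed
  then obtain K where fr: "\<And>i. i < N \<Longrightarrow> framed_compact k (\<sigma> i) (v i) (K i)"
      and K: "\<And>i. i < N \<Longrightarrow> K i \<subseteq> X i" "\<And>i. i < N \<Longrightarrow> hausdorff_outer k (X i - K i) \<le> ennreal (d i)"
    by metis
  note fr' = framed_compactD[OF fr]
  \<comment> \<open>Meaningful only on \<open>C\<close>, where it picks the unique piece containing
    \<open>x\<close>; it turns the family of frames into one map that can be extended.\<close>
  define idx where "idx x = (THE i. i < N \<and> x \<in> K i)" for x
  have disj: "i = j" if "i < N" "j < N" "x \<in> K i" "x \<in> K j" for i j x
    using that K(1)[of i] K(1)[of j] by (auto simp: X_def)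
  have idx: "idx x = i" if "i < N" "x \<in> K i" for i x
    unfolding idx_def using that disj by (intro the_equality) auto
  define C where "C = (\<Union>i\<in>{..<N}. K i)"
  have clK: "closed (K i)" if "i < N" for i using fr'(1)[OF that] by (rule compact_imp_closed)
  have clC: "closed C" unfolding C_def using clK by auto
  have glue: "continuous_on C (\<lambda>x. h (idx x) x)" if "\<And>i. i < N \<Longrightarrow> continuous_on (K i) (h i)"
    for h :: "nat \<Rightarrow> real^'n \<Rightarrow> 'b::topological_space"
    unfolding C_def
  proof (rule continuous_on_closed_Union)
    fix i assume "i \<in> {..<N}"
    then have i: "i < N" by simp
    show "continuous_on (K i) (\<lambda>x. h (idx x) x)"
      using that[OF i] by (rule continuous_on_eq) (simp add: idx[OF i])
  qed (use clK in auto)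
  have CE: "\<exists>i<N. x \<in> K i \<and> idx x = i" if "x \<in> C" for x using that idx by (auto simp: C_def)
  obtain \<omega> where \<omega>: "\<omega> \<in> D0 k E" "\<And>x w. orthonormal_frame k w \<Longrightarrow> \<bar>\<omega> x w\<bar> \<le> 1"
    "\<And>x. x \<in> C \<inter> E \<Longrightarrow> \<omega> x = (\<lambda>w. (t (idx x) * \<sigma> (idx x) x) * gram_form k (v (idx x) x) w)"
  proof (rule frame_form_extension[OF clC, of "\<lambda>x. t (idx x) * \<sigma> (idx x) x" k "\<lambda>x. v (idx x) x" E])
    show "continuous_on C (\<lambda>x. t (idx x) * \<sigma> (idx x) x)"
      using glue[of "\<lambda>i x. t i * \<sigma> i x"] fr'(2) by (auto intro: continuous_on_mult_left)
    show "\<bar>t (idx x) * \<sigma> (idx x) x\<bar> \<le> 1" if "x \<in> C" for x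
    proof -
      obtain i where i: "i < N" "x \<in> K i" "idx x = i" using CE[OF \<open>x \<in> C\<close>] by metis
      then have "\<bar>\<sigma> i x\<bar> = 1" using fr'(4)[OF i(1,2)] by auto
      then show ?thesis using i t[OF i(1)] by (simp add: abs_mult)
    qed
    show "continuous_on C (\<lambda>x. v (idx x) x j)" if "j < k" for j
      using glue[of "\<lambda>i x. v i x j"] fr'(3) that by auto
    show "norm (v (idx x) x j) \<le> 1" if "x \<in> C" "j < k" for x j
    proof -
      obtain i where i: "i < N" "x \<in> K i" "idx x = i" using CE[OF \<open>x \<in> C\<close>] by metis
      then show ?thesis using orthonormal_frame_norm[OF fr'(5)[OF i(1,2)] \<open>j < k\<close>] by simp
    qed
    fix \<omega> assume 1: "\<omega> \<in> D0 k E" and 2: "\<And>x w. orthonormal_frame k w \<Longrightarrow> \<bar>\<omega> x w\<bar> \<le> 1"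
      and 3: "\<And>x. x \<in> C \<inter> E \<Longrightarrow>
        \<omega> x = (\<lambda>w. (t (idx x) * \<sigma> (idx x) x) * gram_form k (v (idx x) x) w)"
    show thesis by (rule that[OF 1 2 3])
  qed
  have avg: "\<bar>avg_current k (S i) (\<sigma> i) (v i) \<omega> - t i\<bar> \<le> e" if i: "i < N" for i
  proof -
    have Ks: "K i \<in> sets ?M" using borel_compact[OF fr'(1)[OF i]] borel_subset_hausdorff by blast
    have KS: "K i \<subseteq> S i" using K(1)[OF i] X(2)[OF i] by blast
    \<comment> \<open>The form need not vanish on \<open>S i - X i\<close>, which lies in the other
      carriers; hence \<open>X = S i\<close> here, and this null set is counted in the error
      region.\<close>
    have "\<bar>form_integral k (S i) (\<sigma> i) (v i) \<omega> - t i * measure ?M (S i)\<bar> \<le> 2 * 1 * measure ?M (S i - K i)"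
    proof (rule form_integral_estimate[OF E \<omega>(1) ad[OF i] ad'(2)[OF i] order_refl Ks KS])
      show "\<sigma> i x * \<omega> x (v i x) = t i" if x: "x \<in> K i" for x
      proof -
        have "x \<in> C \<inter> E" using x i KS ad'(1)[OF i] by (auto simp: C_def)
        then have "\<omega> x (v i x) = t i * \<sigma> i x * gram_form k (v i x) (v i x)"
          using \<omega>(3)[of x] idx[OF i x] by simp
        moreover have "gram_form k (v i x) (v i x) = 1"
          using fr'(5)[OF i x] by (intro gram_form_orthonormal) (simp add: orthonormal_frame_def)
        ultimately show ?thesis using fr'(4)[OF i x] by auto
      qed
    qed (use \<omega>(2) t[OF i] in auto)
    moreover have "measure ?M (S i - K i) \<le> d i"
    proof -
      have "emeasure ?M (S i - K i) = emeasure ?M (X i - K i \<union> (S i - X i))"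
        using K(1)[OF i] X(2)[OF i] by (intro arg_cong[where f="emeasure ?M"]) blast
      also have "\<dots> = emeasure ?M (X i - K i)"
        using SX[OF i] X(1)[OF i] Ks by (intro emeasure_Un_null_set) auto
      also have "\<dots> \<le> ennreal (d i)"
        using K(2)[OF i] emeasure_hausdorff[OF sets.Diff[OF X(1)[OF i] Ks]] by simp
      finally show ?thesis unfolding measure_def
        by (rule enn2real_leI[rotated]) (use d[OF i] in simp)
    qed
    ultimately have "\<bar>form_integral k (S i) (\<sigma> i) (v i) \<omega> - t i * measure ?M (S i)\<bar> \<le> e * measure ?M (S i)"
      by (simp add: d_def)
    moreover have "avg_current k (S i) (\<sigma> i) (v i) \<omega> - t i
        = (form_integral k (S i) (\<sigma> i) (v i) \<omega> - t i * measure ?M (S i)) / measure ?M (S i)"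
      unfolding avg_current_def ad'(6)[OF i] diff_divide_distrib
      using less_imp_neq[OF ad'(5)[OF i]] by (subst nonzero_mult_div_cancel_right) auto
    ultimately show ?thesis using ad'(5)[OF i] by (simp only: abs_divide abs_of_pos pos_divide_le_eq)
  qed
  show ?thesis by (rule that[OF \<omega>(1,2) avg])
qed

text \<open>Keeps the supremum defining the operator norm from being taken over the empty set. One
  current with target 1 and error 1/2 yields a form of positive norm, which is then
  normalised.\<close>

lemma exists_unit_form:
  assumes E: "compact E" and ne: "averaging_currents k E \<noteq> {}"
  obtains \<omega> where "\<omega> \<in> D0 k E" "norm0 k E \<omega> = 1"
proof -
  obtain T where T: "T \<in> averaging_currents k E" using ne unfolding ex_in_conv[symmetric] by (rule exE)
  from T obtain S \<sigma> v where S: "T = avg_current k S \<sigma> v" and ad: "admissible k E S \<sigma> v"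
    unfolding averaging_currents_def by blast
  obtain \<omega> where \<omega>: "\<omega> \<in> D0 k E" "\<bar>T \<omega> - 1\<bar> \<le> 1/2"
  proof (rule exists_form_prescribed_averages[of E "Suc 0" k "\<lambda>_. S" "\<lambda>_. \<sigma>" "\<lambda>_. v" "\<lambda>_. 1" "1/2"])
    fix \<omega> assume 1: "\<omega> \<in> D0 k E"
      and 2: "\<And>i. i < Suc 0 \<Longrightarrow> \<bar>avg_current k S \<sigma> v \<omega> - 1\<bar> \<le> 1/2"
    have "\<bar>T \<omega> - 1\<bar> \<le> 1/2" unfolding S by (rule 2) simp
    then show thesis by (rule that[OF 1])
  qed (use E ad in auto)
  have n: "0 < norm0 k E \<omega>" using abs_le_norm0[OF E \<omega>(1) T] \<omega>(2) by linarith
  have "norm0 k E (lin_comb 1 (\<lambda>_. 1 / norm0 k E \<omega>) (\<lambda>_. \<omega>)) = 1"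
    using norm0_scale[OF E \<omega>(1) ne, of "1 / norm0 k E \<omega>"] n by simp
  moreover have "lin_comb 1 (\<lambda>_. 1 / norm0 k E \<omega>) (\<lambda>_. \<omega>) \<in> D0 k E" using \<omega>(1) by (rule lin_comb_D0)
  ultimately show ?thesis by (intro that)
qed

theorem mainTheorem3:
  fixes E :: "(real^'n) set" and k N :: nat
    and V :: "(real^'n \<Rightarrow> 'n covector) set"
    and T :: "nat \<Rightarrow> (real^'n \<Rightarrow> 'n covector) \<Rightarrow> real"
    and \<omega>s :: "nat \<Rightarrow> real^'n \<Rightarrow> 'n covector"
  assumes domain: "\<exists>\<Omega>. lipschitz_domain \<Omega> \<and> E = closure \<Omega>"
    and subspace: "fin_dim_subspace k N E V"
    and currents: "\<forall>i<N. T i \<in> averaging_currents k E"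
    and unisolvent: "\<forall>\<omega>\<in>V. (\<forall>i<N. T i \<omega> = 0) \<longrightarrow> \<omega> = (\<lambda>_ _. 0)"
    and supports: "\<forall>i<N. \<forall>j<N. i \<noteq> j \<longrightarrow>
                     hausdorff_outer k (current_support k E (T i) \<inter> current_support k E (T j)) = 0"
    and lagrange: "\<forall>i<N. \<omega>s i \<in> V" "\<forall>i<N. \<forall>j<N. T i (\<omega>s j) = (if i = j then 1 else 0)"
  shows "Sup {norm0 k E (interp N T \<omega>s \<omega>) | \<omega>. \<omega> \<in> D0 k E \<and> norm0 k E \<omega> = 1}
         = Sup {(\<Sum>i<N. \<bar>S (\<omega>s i)\<bar>) | S. S \<in> averaging_currents k E}"
proof (cases "averaging_currents k E = {}")
  case True
  \<comment> \<open>Both sides are then the unspecified real \<open>Sup {}\<close>: the norm is constantly \<open>Sup {}\<close>, so the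
    left-hand set is empty or, if \<open>Sup {} = 1\<close>, equal to \<open>{1}\<close>.\<close>
  then have "norm0 k E \<omega> = Sup {}" for \<omega> by (simp add: norm0_eq)
  moreover have "(\<lambda>_ _. 0) \<in> D0 k E"
    using subspace by (auto simp: fin_dim_subspace_def)
  ultimately have "{norm0 k E (interp N T \<omega>s \<omega>) | \<omega>. \<omega> \<in> D0 k E \<and> norm0 k E \<omega> = 1}
      = (if Sup {} = (1 :: real) then {1} else {})" by auto
  then show ?thesis using True by auto
next
  case ne: False
  have E: "compact E"
    using domain by (auto simp: lipschitz_domain_def compact_closure)
  have ws: "\<omega>s i \<in> D0 k E" if "i < N" for i
    using lagrange(1) subspace that by (auto simp: fin_dim_subspace_def)
  have pi: "interp N T \<omega>s \<omega> \<in> D0 k E" for \<omega>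
    unfolding interp_def using ws by (rule lin_comb_D0)
  have Spi: "S (interp N T \<omega>s \<omega>) = (\<Sum>i<N. T i \<omega> * S (\<omega>s i))" if "S \<in> averaging_currents k E" for S \<omega>
    unfolding interp_def using averaging_current_lin_comb[OF E ws that] by simp
  define \<L> where "\<L> = {(\<Sum>i<N. \<bar>S (\<omega>s i)\<bar>) | S. S \<in> averaging_currents k E}"
  define \<P> where "\<P> = {norm0 k E (interp N T \<omega>s \<omega>) | \<omega>. \<omega> \<in> D0 k E \<and> norm0 k E \<omega> = 1}"
  have \<L>_ne: "\<L> \<noteq> {}" using ne by (auto simp: \<L>_def)
  obtain \<omega>1 where \<omega>1: "\<omega>1 \<in> D0 k E" "norm0 k E \<omega>1 = 1" using exists_unit_form[OF E ne] by blast
  have \<P>_mem: "norm0 k E (interp N T \<omega>s \<omega>) \<in> \<P>" if "\<omega> \<in> D0 k E" "norm0 k E \<omega> = 1" for \<omega>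
    unfolding \<P>_def using that by blast
  have \<P>_ne: "\<P> \<noteq> {}" using \<P>_mem[OF \<omega>1] by blast
  \<comment> \<open>Without boundedness the real \<open>Sup\<close> would not be a least upper
    bound; the bound for \<open>\<P>\<close> follows from \<open>upper\<close>.\<close>
  have bdd_\<L>: "bdd_above \<L>"
    unfolding \<L>_def
    by (rule bdd_aboveI[of _ "\<Sum>i<N. norm0 k E (\<omega>s i)"]) (auto intro!: sum_mono abs_le_norm0[OF E ws])
  have upper: "p \<le> Sup \<L>" if p: "p \<in> \<P>" for p
  proof -
    obtain \<omega> where \<omega>: "p = norm0 k E (interp N T \<omega>s \<omega>)" "\<omega> \<in> D0 k E" "norm0 k E \<omega> = 1"
      using p unfolding \<P>_def by blast
    show ?thesis unfolding \<omega>(1)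
    proof (rule norm0_le[OF ne])
      fix S assume S: "S \<in> averaging_currents k E"
      have "\<bar>S (interp N T \<omega>s \<omega>)\<bar> \<le> (\<Sum>i<N. \<bar>T i \<omega>\<bar> * \<bar>S (\<omega>s i)\<bar>)"
        unfolding Spi[OF S] by (rule order_trans[OF sum_abs]) (simp add: abs_mult)
      also have "\<dots> \<le> (\<Sum>i<N. 1 * \<bar>S (\<omega>s i)\<bar>)"
        using abs_le_norm0[OF E \<omega>(2)] \<omega>(3) currents by (intro sum_mono mult_right_mono) fastforce+
      also have "\<dots> \<le> Sup \<L>"
        using S by (intro cSup_upper bdd_\<L>) (auto simp: \<L>_def)
      finally show "\<bar>S (interp N T \<omega>s \<omega>)\<bar> \<le> Sup \<L>" .
    qed
  qed
  have bdd_\<P>: "bdd_above \<P>" using upper by (rule bdd_aboveI)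
  have norm0_nonneg: "0 \<le> norm0 k E \<omega>" if "\<omega> \<in> D0 k E" for \<omega>
    using abs_le_norm0[OF E that] ne by fastforce
  have \<P>_nonneg: "0 \<le> Sup \<P>"
    using norm0_nonneg[OF pi, of \<omega>1] cSup_upper[OF \<P>_mem[OF \<omega>1] bdd_\<P>] by linarith
  \<comment> \<open>The constructed forms are only known to have norm at most 1, while
    \<open>\<P>\<close> admits norm exactly 1, so a homogeneous bound is required. A form of norm 0
    cannot be normalised, but all \<open>T i\<close> vanish on it.\<close>
  have op: "norm0 k E (interp N T \<omega>s \<omega>) \<le> Sup \<P> * norm0 k E \<omega>" if \<omega>: "\<omega> \<in> D0 k E" for \<omega>
  proof (cases "norm0 k E \<omega> = 0")
    case True
    then have "T i \<omega> = 0" if "i < N" for i using abs_le_norm0[OF E \<omega>, of "T i"] currents that by auto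
    then have "S (interp N T \<omega>s \<omega>) = 0" if "S \<in> averaging_currents k E" for S
      unfolding Spi[OF that] by simp
    then have "norm0 k E (interp N T \<omega>s \<omega>) \<le> 0" by (intro norm0_le[OF ne]) simp
    then show ?thesis using True by simp
  next
    case False
    define a where "a = 1 / norm0 k E \<omega>"
    have a: "0 < a" using False norm0_nonneg[OF \<omega>] by (simp add: a_def)
    let ?\<eta> = "lin_comb 1 (\<lambda>_. a) (\<lambda>_. \<omega>)"
    have "norm0 k E ?\<eta> = 1" using norm0_scale[OF E \<omega> ne a] False by (simp add: a_def)
    moreover have "?\<eta> \<in> D0 k E" using \<omega> by (rule lin_comb_D0)
    ultimately have "norm0 k E (interp N T \<omega>s ?\<eta>) \<le> Sup \<P>"
      by (intro cSup_upper bdd_\<P> \<P>_mem)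
    moreover have "T i ?\<eta> = a * T i \<omega>" if "i < N" for i
      using averaging_current_scale[OF E \<omega>, of "T i"] currents that by blast
    then have "interp N T \<omega>s ?\<eta> = lin_comb 1 (\<lambda>_. a) (\<lambda>_. interp N T \<omega>s \<omega>)"
      unfolding interp_def lin_comb_def[of N]
      by (simp add: lin_comb_def[of "Suc 0"] lessThan_Suc sum_distrib_left mult.assoc)
    ultimately have "a * norm0 k E (interp N T \<omega>s \<omega>) \<le> Sup \<P>"
      using norm0_scale[OF E pi ne a] by simp
    then show ?thesis using a by (simp add: a_def field_simps)
  qed
  have "\<forall>i\<in>{..<N}. \<exists>S \<sigma> v. T i = avg_current k S \<sigma> v \<and> admissible k E S \<sigma> v"
    using currents unfolding averaging_currents_def by blast
  then obtain C \<sigma> v where C: "\<And>i. i < N \<Longrightarrow> T i = avg_current k (C i) (\<sigma> i) (v i)"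
      "\<And>i. i < N \<Longrightarrow> admissible k E (C i) (\<sigma> i) (v i)"
    by (metis lessThan_iff)
  have null: "hausdorff_outer k (C i \<inter> C j) = 0" if "i < N" "j < N" "i \<noteq> j" for i j
    using carriers_Int_null[OF E C(2) C(2), of i j] supports that C(1) by simp
  have "l \<le> Sup \<P>" if l: "l \<in> \<L>" for l
  proof -
    obtain S where S: "S \<in> averaging_currents k E" "l = (\<Sum>i<N. \<bar>S (\<omega>s i)\<bar>)"
      using l unfolding \<L>_def by blast
    have "l \<le> Sup \<P> + e * l" if e: "0 < e" for e
    proof -
      obtain \<omega> where \<omega>: "\<omega> \<in> D0 k E" "\<And>x w. orthonormal_frame k w \<Longrightarrow> \<bar>\<omega> x w\<bar> \<le> 1"
        "\<And>i. i < N \<Longrightarrow> \<bar>avg_current k (C i) (\<sigma> i) (v i) \<omega> - sgn (S (\<omega>s i))\<bar> \<le> e"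
        by (rule exists_form_prescribed_averages[where S=C and \<sigma>=\<sigma> and v=v
              and t="\<lambda>i. sgn (S (\<omega>s i))", OF E C(2) null _ e]) (auto simp: abs_sgn_eq)
      have n1: "norm0 k E \<omega> \<le> 1"
        using averaging_currents_bound[OF E \<omega>(1) _ _ \<omega>(2)] by (intro norm0_le[OF ne]) simp
      \<comment> \<open>Since the absolute value of \<open>y\<close> is \<open>sgn y * y\<close>,
        exact signs would give \<open>S (interp N T \<omega>s \<omega>) = l\<close>; the error is at
        most \<open>e\<close> times \<open>l\<close>.\<close>
      have "l - S (interp N T \<omega>s \<omega>) = (\<Sum>i<N. (sgn (S (\<omega>s i)) - T i \<omega>) * S (\<omega>s i))"
        unfolding S(2) Spi[OF S(1)]
        by (simp add: sum_subtractf[symmetric] algebra_simps abs_sgn)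
      also have "\<dots> \<le> (\<Sum>i<N. e * \<bar>S (\<omega>s i)\<bar>)"
      proof (rule sum_mono)
        fix i assume "i \<in> {..<N}"
        then have "\<bar>sgn (S (\<omega>s i)) - T i \<omega>\<bar> \<le> e" using \<omega>(3)[of i] C(1)[of i] by (simp add: abs_minus_commute)
        then have "\<bar>(sgn (S (\<omega>s i)) - T i \<omega>) * S (\<omega>s i)\<bar> \<le> e * \<bar>S (\<omega>s i)\<bar>"
          unfolding abs_mult by (rule mult_right_mono) simp
        then show "(sgn (S (\<omega>s i)) - T i \<omega>) * S (\<omega>s i) \<le> e * \<bar>S (\<omega>s i)\<bar>" by linarith
      qed
      also have "\<dots> = e * l" by (simp add: S(2) sum_distrib_left)
      finally have "l \<le> S (interp N T \<omega>s \<omega>) + e * l" by simp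
      moreover have "S (interp N T \<omega>s \<omega>) \<le> norm0 k E (interp N T \<omega>s \<omega>)"
        using abs_le_norm0[OF E pi S(1)] by (meson abs_ge_self order_trans)
      moreover have "norm0 k E (interp N T \<omega>s \<omega>) \<le> Sup \<P>"
        using op[OF \<omega>(1)] mult_left_mono[OF n1 \<P>_nonneg] by simp
      ultimately show ?thesis by linarith
    qed
    moreover have "0 \<le> l" unfolding S(2) by (simp add: sum_nonneg)
    ultimately have le: "l \<le> Sup \<P> + \<delta>" if "0 < \<delta>" for \<delta>
    proof -
      \<comment> \<open>The relative error is made absolute; \<open>l + 1\<close> keeps the
        denominator positive when \<open>l = 0\<close>.\<close>
      have "l \<le> Sup \<P> + \<delta> / (l + 1) * l"
        using \<open>\<And>e. 0 < e \<Longrightarrow> l \<le> Sup \<P> + e * l\<close>[of "\<delta> / (l + 1)"] \<open>0 \<le> l\<close> that by simp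
      also have "\<delta> / (l + 1) * l \<le> \<delta>" using \<open>0 \<le> l\<close> that by (simp add: field_simps)
      finally show ?thesis by simp
    qed
    then show ?thesis by (rule field_le_epsilon)
  qed
  then have "Sup \<L> \<le> Sup \<P>" using \<L>_ne by (intro cSup_least)
  moreover have "Sup \<P> \<le> Sup \<L>" using \<P>_ne upper by (rule cSup_least)
  ultimately show ?thesis unfolding \<L>_def \<P>_def by simp
qed

end
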